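(* Let $\beta\in\mathbb{R}$ and $\gamma\in\mathbb{R}\setminus\{0\}$, and for $t>0$ let $\nu_t$ be the equilibrium measure of total mass $t$ in $[0,+\infty)$ in the external field $\phi(x)=\frac12x^2+\beta x+\gamma\log(x+1)$. Then there exists $T=T(\beta,\gamma)>0$ such that for every $t>T$ the measure $\nu_t$ is absolutely continuous with support $[0,a_1]$ and density of the form $$\nu_t'(x)=\frac1\pi\,\frac{(x-b_1)(x-b_2)}{x+1}\sqrt{\frac{a_1-x}{x}},\qquad x\in(0,a_1),$$ where $a_1=a_1(t)>0$ and $b_1=b_1(t)$, $b_2=b_2(t)$ are real with $b_2<b_1$, $b_2\in(-\infty,-1)$, $b_1\in(-\infty,0)$, and $$\lim_{t\to\infty}a_1(t)=+\infty,\qquad \lim_{t\to\infty}b_2(t)=-\infty,\qquad \lim_{t\to\infty}b_1(t)=-1.$$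
   Context: Equilibrium measure: for a closed set $\Sigma\subset\mathbb{R}$, an external field $\phi$ on $\Sigma$ and $t>0$, the equilibrium measure of total mass $t$ in $\Sigma$ in the external field $\phi$ is the unique positive Borel measure $\nu_t$ with $\nu_t(\Sigma)=t$ and compact support $S_t\subset\Sigma$ such that, for some constant $c_t$, $V^{\nu_t}(x)+\phi(x)=c_t$ for $x\in S_t$ and $\ge c_t$ for $x\in\Sigma$, where $V^{\sigma}(x)=-\int\log|x-s|\,d\sigma(s)$. Equivalently, it minimizes $-\iint\log|x-z|\,d\sigma(x)d\sigma(z)+2\int\phi\,d\sigma$ over positive measures $\sigma$ on $\Sigma$ with total mass $t$. *)

theory Defs
  imports "HOL-Analysis.Analysis"
begin

definition measure_support :: "real measure \<Rightarrow> real set" where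
  "measure_support \<nu> = {x. \<forall>U. open U \<longrightarrow> x \<in> U \<longrightarrow> emeasure \<nu> U > 0}"

text \<open>
  The kernel \<open>-log |x - s|\<close> is \<open>\<infinity>\<close> on the diagonal; since \<open>ln 0 = 0\<close> for type \<^typ>\<open>real\<close>,
  the value must be given separately, for otherwise point masses would not be seen by the potential.
\<close>

definition log_kernel :: "real \<Rightarrow> real \<Rightarrow> ereal" where
  "log_kernel x s = (if x = s then \<infinity> else ereal (- ln \<bar>x - s\<bar>))"

text \<open>
  The potential \<open>V\<close> with values in \<open>(-\<infinity>, \<infinity>]\<close>, as the integral of the positive part of the
  kernel minus that of the negative part (\<^const>\<open>e2ennreal\<close> truncates negative values to 0).
  The second integral is finite if the measure is finite with compact support. A Bochner integral
  would take the value 0 where the kernel is not integrable.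
\<close>

definition log_potential :: "real measure \<Rightarrow> real \<Rightarrow> ereal" where
  "log_potential \<nu> x =
     enn2ereal (\<integral>\<^sup>+ s. e2ennreal (log_kernel x s) \<partial>\<nu>)
     - enn2ereal (\<integral>\<^sup>+ s. e2ennreal (- log_kernel x s) \<partial>\<nu>)"

text \<open>
  Measures on \<open>\<Sigma>\<close> are represented as Borel measures on the whole line whose support is
  contained in \<open>\<Sigma>\<close>; the complement of the support is a null set.
\<close>

definition is_equilibrium_measure ::
    "real set \<Rightarrow> (real \<Rightarrow> real) \<Rightarrow> real \<Rightarrow> real measure \<Rightarrow> bool" where
  "is_equilibrium_measure \<Sigma> \<phi> t \<nu> \<longleftrightarrow>
     sets \<nu> = sets borel \<and>
     emeasure \<nu> \<Sigma> = ennreal t \<and>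
     compact (measure_support \<nu>) \<and>
     measure_support \<nu> \<subseteq> \<Sigma> \<and>
     (\<exists>c::real.
        (\<forall>x\<in>measure_support \<nu>. log_potential \<nu> x + ereal (\<phi> x) = ereal c) \<and>
        (\<forall>x\<in>\<Sigma>. log_potential \<nu> x + ereal (\<phi> x) \<ge> ereal c))"

definition equilibrium_measure ::
    "real set \<Rightarrow> (real \<Rightarrow> real) \<Rightarrow> real \<Rightarrow> real measure" where
  "equilibrium_measure \<Sigma> \<phi> t = (THE \<nu>. is_equilibrium_measure \<Sigma> \<phi> t \<nu>)"

end

theory Submission
  imports
    Defs
    "HOL-Probability.Probability"
    "HOL-Complex_Analysis.Complex_Analysis"
    "HOL-Real_Asymp.Real_Asymp"
begin

text \<open>
  Uniqueness of equilibrium measures comes from the positive definiteness of the logarithmic kernel: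
  \<open>ln (z\<^sup>2 + M\<^sup>2) / 2 - ln (z\<^sup>2 + \<epsilon>\<^sup>2) / 2\<close> is the integral of the Poisson kernels \<open>s / (z\<^sup>2 + s\<^sup>2)\<close> over
  \<open>\<epsilon> \<le> s \<le> M\<close>, and \<open>s / (z\<^sup>2 + s\<^sup>2)\<close> is the integral of \<open>exp (- s \<xi>) cos (\<xi> z)\<close> over \<open>\<xi> > 0\<close>, so that
  the energy of \<open>\<mu> - \<nu>\<close> controls \<open>\<bar>char \<mu> \<xi> - char \<nu> \<xi>\<bar>\<^sup>2\<close>. Let \<open>\<epsilon> \<rightarrow> 0\<close>, then \<open>M \<rightarrow> \<infinity>\<close>: the equilibrium
  conditions force this energy to vanish.

  For existence, substitute \<open>x = - (a / 4) (w - 1)\<^sup>2 / w\<close>, which maps the unit circle onto \<open>[0, a]\<close> and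
  \<open>w < -1\<close> onto \<open>x > a\<close>. The measure becomes a density on the circle, namely a trigonometric
  polynomial of degree 2 plus a multiple of the Poisson kernel at the image \<open>\<kappa>\<close> of the pole \<open>x = -1\<close>.
  Its potential is explicit by Cauchy's formula, constant after adding the field when \<open>\<bar>w\<bar> = 1\<close>, and
  increasing in \<open>-w > 1\<close>. The mass \<open>t\<close> is \<open>3 a\<^sup>2 / 8 + a \<beta> / 2 + \<gamma> - \<gamma> / sqrt (1 + a)\<close>, and every large \<open>t\<close> is
  attained.
\<close>

section \<open>Uniqueness of equilibrium measures\<close>

text \<open>The kernel \<open>- ln \<bar>z\<bar>\<close> is unbounded in both directions, and
  finiteness of the energies involved is not given in advance, so they cannot simply be subtracted.
  The two cutoffs answer this: \<open>\<epsilon>\<close> makes the kernel bounded, which justifies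
  Fubini's theorem, and \<open>M\<close> makes it nonnegative, so that the monotone limit
  \<open>\<epsilon> \<rightarrow> 0\<close> can be taken in \<open>[0, \<infinity>]\<close>. For a
  measure of mass \<open>t\<close> with bounded support, the cutoff \<open>M\<close> only adds
  \<open>t * ln M\<close> to the potential on bounded sets, up to an error of order
  \<open>1 / M\<^sup>2\<close>; between two measures of equal mass these constants cancel. For
  existence, the circle is used because \<open>sqrt ((a - x) / x)\<close> becomes rational in
  \<open>w\<close>. The endpoint \<open>a\<close> replaces \<open>t\<close> as the parameter: given
  \<open>a\<close>, the zeros of the density solve a quadratic equation and the mass is explicit,
  while \<open>a\<close> as a function of \<open>t\<close> is not.\<close>

definition mutual_integral :: "real measure \<Rightarrow> real measure \<Rightarrow> (real \<Rightarrow> real) \<Rightarrow> real" where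
  "mutual_integral \<mu> \<nu> f = (\<integral>x. (\<integral>y. f (x - y) \<partial>\<nu>) \<partial>\<mu>)"

text \<open>This is the energy of the signed measure \<open>\<mu> - \<nu>\<close>, expanded
  bilinearly so that only positive measures are integrated against.\<close>

definition diff_energy :: "real measure \<Rightarrow> real measure \<Rightarrow> (real \<Rightarrow> real) \<Rightarrow> real" where
  "diff_energy \<mu> \<nu> f = mutual_integral \<mu> \<mu> f + mutual_integral \<nu> \<nu> f
     - mutual_integral \<mu> \<nu> f - mutual_integral \<nu> \<mu> f"

text \<open>Fubini for a superposition of uniformly bounded kernels. Through its analogue for
  \<open>diff_energy\<close> it serves twice: with \<open>p\<close> a frequency weighted by
  \<open>exp (- (\<xi> * s))\<close>, where cosines build a Poisson kernel, and with
  \<open>p\<close> a scale in \<open>{\<epsilon>..M}\<close>, where Poisson kernels build the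
  truncated logarithm.\<close>

lemma mutual_integral_mixture:
  fixes F :: "'p \<Rightarrow> real \<Rightarrow> real"
  assumes "finite_borel_measure \<mu>" "finite_borel_measure \<nu>" "finite_measure N"
    and meas: "(\<lambda>(p, z). F p z) \<in> borel_measurable (N \<Otimes>\<^sub>M borel)"
    and bound: "\<And>p z. p \<in> space N \<Longrightarrow> \<bar>F p z\<bar> \<le> C"
  shows "integrable N (\<lambda>p. mutual_integral \<mu> \<nu> (F p))"
    and "mutual_integral \<mu> \<nu> (\<lambda>z. \<integral>p. F p z \<partial>N) = (\<integral>p. mutual_integral \<mu> \<nu> (F p) \<partial>N)"
proof -
  interpret M: finite_borel_measure \<mu> by fact
  interpret V: finite_borel_measure \<nu> by fact
  interpret N: finite_measure N by fact
  interpret NV: pair_sigma_finite N \<nu> ..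
  interpret NM: pair_sigma_finite N \<mu> ..
  interpret fNV: finite_measure "N \<Otimes>\<^sub>M \<nu>"
    by (rule finite_measure_pair_measure) unfold_locales
  interpret fNM: finite_measure "N \<Otimes>\<^sub>M \<mu>"
    by (rule finite_measure_pair_measure) unfold_locales
  have [measurable_cong]: "sets \<mu> = sets borel" "sets \<nu> = sets borel"
    by (simp_all add: M.M_is_borel V.M_is_borel)
  have [measurable]: "(\<lambda>q. F (g q) (h q)) \<in> borel_measurable Q"
    if "g \<in> measurable Q N" "h \<in> borel_measurable Q" for g h and Q :: "'q measure"
    using measurable_compose[OF measurable_Pair[OF that] meas] by simp
  have "0 \<le> C" if "p \<in> space N" for p using bound[OF that, of 0] by linarith
  have inner: "integrable (N \<Otimes>\<^sub>M \<nu>) (\<lambda>(p, y). F p (x - y))" for x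
    by (rule fNV.integrable_const_bound[where B = C])
       (auto intro!: AE_I2 bound simp: space_pair_measure)
  define K where "K p x = (\<integral>y. F p (x - y) \<partial>\<nu>)" for p x
  have [measurable]: "(\<lambda>(p, x). K p x) \<in> borel_measurable (N \<Otimes>\<^sub>M \<mu>)"
    unfolding K_def by measurable
  have Kb: "\<bar>K p x\<bar> \<le> C * measure \<nu> (space \<nu>)" if "p \<in> space N" for p x
  proof -
    have "\<bar>K p x\<bar> \<le> (\<integral>y. \<bar>F p (x - y)\<bar> \<partial>\<nu>)"
      unfolding K_def by (rule integral_abs_bound)
    also have "\<dots> \<le> (\<integral>y. C \<partial>\<nu>)"
      by (rule integral_mono_AE)
         (use that in \<open>auto intro!: V.integrable_const_bound[where B = C] AE_I2 bound\<close>)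
    finally show ?thesis by (simp add: mult.commute)
  qed
  have outer: "integrable (N \<Otimes>\<^sub>M \<mu>) (\<lambda>(p, x). K p x)"
    by (rule fNM.integrable_const_bound[where B = "C * measure \<nu> (space \<nu>)"])
       (auto intro!: AE_I2 Kb simp: space_pair_measure)
  show "integrable N (\<lambda>p. mutual_integral \<mu> \<nu> (F p))"
    using NM.integrable_fst'[OF outer] by (simp add: mutual_integral_def K_def)
  have "mutual_integral \<mu> \<nu> (\<lambda>z. \<integral>p. F p z \<partial>N) = (\<integral>x. (\<integral>p. K p x \<partial>N) \<partial>\<mu>)"
    unfolding mutual_integral_def K_def
    by (intro Bochner_Integration.integral_cong refl) (use NV.Fubini_integral[OF inner] in simp)
  also have "\<dots> = (\<integral>p. mutual_integral \<mu> \<nu> (F p) \<partial>N)"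
    using NM.Fubini_integral[OF outer] by (simp add: mutual_integral_def K_def)
  finally show "mutual_integral \<mu> \<nu> (\<lambda>z. \<integral>p. F p z \<partial>N) = (\<integral>p. mutual_integral \<mu> \<nu> (F p) \<partial>N)" .
qed

lemma diff_energy_mixture:
  fixes F :: "'p \<Rightarrow> real \<Rightarrow> real"
  assumes "finite_borel_measure \<mu>" "finite_borel_measure \<nu>" "finite_measure N"
    and "(\<lambda>(p, z). F p z) \<in> borel_measurable (N \<Otimes>\<^sub>M borel)"
    and "\<And>p z. p \<in> space N \<Longrightarrow> \<bar>F p z\<bar> \<le> C"
  shows "integrable N (\<lambda>p. diff_energy \<mu> \<nu> (F p))"
    and "diff_energy \<mu> \<nu> (\<lambda>z. \<integral>p. F p z \<partial>N) = (\<integral>p. diff_energy \<mu> \<nu> (F p) \<partial>N)"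
proof -
  note mix = mutual_integral_mixture[OF _ _ assms(3-5)]
  note int = mix(1)[OF assms(1,1)] mix(1)[OF assms(2,2)] mix(1)[OF assms(1,2)] mix(1)[OF assms(2,1)]
  show "integrable N (\<lambda>p. diff_energy \<mu> \<nu> (F p))"
    unfolding diff_energy_def by (intro Bochner_Integration.integrable_diff Bochner_Integration.integrable_add int)
  show "diff_energy \<mu> \<nu> (\<lambda>z. \<integral>p. F p z \<partial>N) = (\<integral>p. diff_energy \<mu> \<nu> (F p) \<partial>N)"
    using mix(2)[OF assms(1,1)] mix(2)[OF assms(2,2)] mix(2)[OF assms(1,2)] mix(2)[OF assms(2,1)]
    by (simp add: diff_energy_def int)
qed

section \<open>Energies for cosines and Poisson kernels\<close>

lemma integrable_iexp:
  assumes "finite_borel_measure \<mu>"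
  shows "integrable \<mu> (\<lambda>x. iexp (\<xi> * x))"
proof -
  interpret finite_borel_measure \<mu> by fact
  have [measurable_cong]: "sets \<mu> = sets borel" by (rule M_is_borel)
  show ?thesis by (rule integrable_const_bound[where B = 1]) auto
qed

lemma mutual_integral_cos:
  assumes "finite_borel_measure \<mu>" "finite_borel_measure \<nu>"
  shows "mutual_integral \<mu> \<nu> (\<lambda>z. cos (\<xi> * z)) = Re (char \<mu> \<xi> * cnj (char \<nu> \<xi>))"
proof -
  note i = integrable_iexp[OF assms(1), of \<xi>] integrable_iexp[OF assms(2), of \<xi>]
  have *: "cos (\<xi> * (x - y)) = Re (iexp (\<xi> * x) * cnj (iexp (\<xi> * y)))" for x y
    by (simp add: exp_Euler cos_diff right_diff_distrib Complex.Re_exp Complex.Im_exp exp_of_real cos_of_real sin_of_real flip: of_real_mult)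
  have "(\<integral>y. cos (\<xi> * (x - y)) \<partial>\<nu>) = Re (iexp (\<xi> * x) * cnj (char \<nu> \<xi>))" for x
    unfolding * char_def using i(2)
    by (subst integral_Re) (auto simp del: times_complex.sel)
  then show ?thesis
    unfolding mutual_integral_def using i(1)
    by (simp del: times_complex.sel add: char_def integral_Re)
qed

text \<open>The four products of characteristic functions complete a square; all positivity in the
  uniqueness proof comes from here.\<close>

lemma diff_energy_cos:
  assumes "finite_borel_measure \<mu>" "finite_borel_measure \<nu>"
  shows "diff_energy \<mu> \<nu> (\<lambda>z. cos (\<xi> * z)) = (cmod (char \<mu> \<xi> - char \<nu> \<xi>))\<^sup>2"
  unfolding diff_energy_def using assms
  by (simp add: mutual_integral_cos cmod_power2) (simp add: power2_eq_square algebra_simps)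

lemma integral_exp_cos:
  fixes s z :: real
  assumes "s > 0"
  shows "integrable lborel (\<lambda>\<xi>. indicator {0<..} \<xi> *\<^sub>R exp (- (\<xi> * s)))"
    and "(\<integral>\<xi>. indicator {0<..} \<xi> *\<^sub>R (exp (- (\<xi> * s)) * cos (\<xi> * z)) \<partial>lborel) = s / (z\<^sup>2 + s\<^sup>2)"
proof -
  show exp: "integrable lborel (\<lambda>\<xi>. indicator {0<..} \<xi> *\<^sub>R exp (- (\<xi> * s)))"
    using integrable_I0i_exp_mscale[OF assms] by (simp add: set_integrable_def)
  have int: "integrable lborel (\<lambda>\<xi>. indicator {0<..} \<xi> *\<^sub>R (exp (- (\<xi> * s)) * cos (\<xi> * z)))"
    by (rule Bochner_Integration.integrable_bound[OF exp])
       (auto intro!: AE_I2 mult_left_le simp: abs_mult split: split_indicator)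
  have pos: "z\<^sup>2 + s\<^sup>2 > 0" using assms by (intro add_nonneg_pos) auto
  \<comment> \<open>\<open>F\<close> is the real part of
    \<open>exp ((\<i> * z - s) * \<xi>) / (\<i> * z - s)\<close>.\<close>
  define F where "F \<xi> = exp (- (\<xi> * s)) * ((z * sin (\<xi> * z) - s * cos (\<xi> * z)) / (z\<^sup>2 + s\<^sup>2))" for \<xi>
  have deriv: "(F has_real_derivative exp (- (\<xi> * s)) * cos (\<xi> * z)) (at \<xi>)" for \<xi>
    unfolding F_def using pos
    by (auto intro!: derivative_eq_intros simp: divide_simps; simp add: algebra_simps power2_eq_square)
  have lim0: "(F \<longlongrightarrow> - s / (z\<^sup>2 + s\<^sup>2)) (at_right 0)"
    using DERIV_isCont[OF deriv, of 0]
    by (auto simp: F_def isCont_def intro: filterlim_at_split[THEN iffD1, THEN conjunct2])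
  have "((\<lambda>\<xi>. exp (- (\<xi> * s)) * ((\<bar>z\<bar> + s) / (z\<^sup>2 + s\<^sup>2))) \<longlongrightarrow> 0) at_top"
    using assms by real_asymp
  then have "(F \<longlongrightarrow> 0) at_top"
  proof (rule Lim_null_comparison[rotated], intro always_eventually allI)
    fix \<xi> :: real
    have "\<bar>z * sin (\<xi> * z) - s * cos (\<xi> * z)\<bar> \<le> \<bar>z\<bar> * 1 + \<bar>s\<bar> * 1"
      by (rule order_trans[OF abs_triangle_ineq4]) (auto simp: abs_mult intro!: add_mono mult_left_le)
    then show "norm (F \<xi>) \<le> exp (- (\<xi> * s)) * ((\<bar>z\<bar> + s) / (z\<^sup>2 + s\<^sup>2))"
      using assms pos by (auto simp: F_def abs_mult intro!: mult_left_mono divide_right_mono)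
  qed
  then have limi: "((F \<circ> real_of_ereal) \<longlongrightarrow> 0) (at_left \<infinity>)"
    by (simp add: ereal_tendsto_simps)
  have "(LBINT \<xi>=0..\<infinity>. exp (- (\<xi> * s)) * cos (\<xi> * z)) = 0 - (- s / (z\<^sup>2 + s\<^sup>2))"
    by (rule interval_integral_FTC_integrable[where F = F])
       (use deriv int lim0 limi in \<open>auto simp: has_real_derivative_iff_has_vector_derivative
          set_integrable_def zero_ereal_def ereal_tendsto_simps intro!: continuous_intros\<close>)
  then show "(\<integral>\<xi>. indicator {0<..} \<xi> *\<^sub>R (exp (- (\<xi> * s)) * cos (\<xi> * z)) \<partial>lborel) = s / (z\<^sup>2 + s\<^sup>2)"
    by (simp add: interval_lebesgue_integral_0_infty set_lebesgue_integral_def)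
qed

lemma integral_poisson_over_scale:
  fixes \<epsilon> M z :: real
  assumes "0 < \<epsilon>" "\<epsilon> \<le> M"
  shows "(\<integral>s. s / (z\<^sup>2 + s\<^sup>2) \<partial>restrict_space lborel {\<epsilon>..M}) = ln (z\<^sup>2 + M\<^sup>2) / 2 - ln (z\<^sup>2 + \<epsilon>\<^sup>2) / 2"
proof -
  have pos: "z\<^sup>2 + s\<^sup>2 > 0" if "s \<ge> \<epsilon>" for s
    using assms that by (intro add_nonneg_pos) auto
  have "(\<integral>s. s / (z\<^sup>2 + s\<^sup>2) * indicator {\<epsilon>..M} s \<partial>lborel) = ln (z\<^sup>2 + M\<^sup>2) / 2 - ln (z\<^sup>2 + \<epsilon>\<^sup>2) / 2"
  proof (rule integral_FTC_Icc_real)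
    fix s assume "\<epsilon> \<le> s" "s \<le> M"
    note p = pos[OF this(1)]
    then show "((\<lambda>s. ln (z\<^sup>2 + s\<^sup>2) / 2) has_real_derivative s / (z\<^sup>2 + s\<^sup>2)) (at s)"
      by (auto intro!: derivative_eq_intros simp: divide_simps)
    show "isCont (\<lambda>s. s / (z\<^sup>2 + s\<^sup>2)) s" using p by (auto intro!: continuous_intros)
  qed (use assms in auto)
  then show ?thesis
    by (subst integral_restrict_space) (auto simp: mult.commute)
qed

text \<open>In this form the energy is a Laplace transform in \<open>s\<close> of a nonnegative
  function, so it is visibly nonnegative and decreasing in \<open>s\<close>; the kernel itself does
  not show this.\<close>

lemma diff_energy_poisson:
  assumes fin: "finite_borel_measure \<mu>" "finite_borel_measure \<nu>" and "s > 0"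
  shows "integrable lborel (\<lambda>\<xi>. indicator {0<..} \<xi> *\<^sub>R (exp (- (\<xi> * s)) * (cmod (char \<mu> \<xi> - char \<nu> \<xi>))\<^sup>2))"
    and "diff_energy \<mu> \<nu> (\<lambda>z. s / (z\<^sup>2 + s\<^sup>2))
      = (\<integral>\<xi>. indicator {0<..} \<xi> *\<^sub>R (exp (- (\<xi> * s)) * (cmod (char \<mu> \<xi> - char \<nu> \<xi>))\<^sup>2) \<partial>lborel)"
proof -
  define N where "N = density lborel (\<lambda>\<xi>. ennreal (indicator {0<..} \<xi> *\<^sub>R exp (- (\<xi> * s))))"
  define G where "G \<xi> = (cmod (char \<mu> \<xi> - char \<nu> \<xi>))\<^sup>2" for \<xi>
  have [measurable_cong]: "sets N = sets borel" by (simp add: N_def)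
  note exp = integral_exp_cos(1)[OF \<open>s > 0\<close>]
  have "emeasure N (space N) < \<infinity>"
    using nn_integral_eq_integral[OF exp] unfolding N_def by (simp add: emeasure_density)
  then interpret N: finite_measure N by (intro finite_measureI) auto
  note mix = diff_energy_mixture[OF fin N.finite_measure_axioms, of "\<lambda>\<xi> z. cos (\<xi> * z)" 1]
  have *: "diff_energy \<mu> \<nu> (\<lambda>z. cos (\<xi> * z)) = G \<xi>" for \<xi>
    by (simp add: diff_energy_cos[OF fin] G_def)
  have int: "integrable N G" using mix(1) by (simp add: *)
  then have [measurable]: "G \<in> borel_measurable borel"
    by (simp add: N_def borel_measurable_integrable[of N, unfolded N_def] borel_measurable_integrable)
  show "integrable lborel (\<lambda>\<xi>. indicator {0<..} \<xi> *\<^sub>R (exp (- (\<xi> * s)) * (cmod (char \<mu> \<xi> - char \<nu> \<xi>))\<^sup>2))"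
    using int unfolding N_def by (subst (asm) integrable_density) (auto simp: G_def mult.assoc)
  have "(\<integral>\<xi>. cos (\<xi> * z) \<partial>N) = s / (z\<^sup>2 + s\<^sup>2)" for z
    unfolding N_def using integral_exp_cos(2)[OF \<open>s > 0\<close>, of z]
    by (subst integral_density) (auto simp: mult.assoc)
  then have "diff_energy \<mu> \<nu> (\<lambda>z. s / (z\<^sup>2 + s\<^sup>2)) = (\<integral>\<xi>. G \<xi> \<partial>N)"
    using mix(2) by (simp add: *)
  also have "\<dots> = (\<integral>\<xi>. indicator {0<..} \<xi> *\<^sub>R (exp (- (\<xi> * s)) * G \<xi>) \<partial>lborel)"
    unfolding N_def by (subst integral_density) (auto simp: mult.assoc)
  finally show "diff_energy \<mu> \<nu> (\<lambda>z. s / (z\<^sup>2 + s\<^sup>2))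
      = (\<integral>\<xi>. indicator {0<..} \<xi> *\<^sub>R (exp (- (\<xi> * s)) * (cmod (char \<mu> \<xi> - char \<nu> \<xi>))\<^sup>2) \<partial>lborel)"
    by (simp add: G_def)
qed

lemma diff_energy_poisson_nonneg:
  assumes "finite_borel_measure \<mu>" "finite_borel_measure \<nu>" "s > 0"
  shows "diff_energy \<mu> \<nu> (\<lambda>z. s / (z\<^sup>2 + s\<^sup>2)) \<ge> 0"
  unfolding diff_energy_poisson(2)[OF assms] by (rule Bochner_Integration.integral_nonneg) auto

lemma diff_energy_poisson_antimono:
  assumes "finite_borel_measure \<mu>" "finite_borel_measure \<nu>" "0 < s" "s \<le> s'"
  shows "diff_energy \<mu> \<nu> (\<lambda>z. s' / (z\<^sup>2 + s'\<^sup>2)) \<le> diff_energy \<mu> \<nu> (\<lambda>z. s / (z\<^sup>2 + s\<^sup>2))"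
proof -
  have "s' > 0" using assms by simp
  show ?thesis
    unfolding diff_energy_poisson(2)[OF assms(1-3)] diff_energy_poisson(2)[OF assms(1,2) \<open>s' > 0\<close>]
    using assms \<open>s' > 0\<close>
    by (intro integral_mono diff_energy_poisson(1))
       (auto split: split_indicator intro!: mult_right_mono)
qed

section \<open>Truncated logarithms and the limit of vanishing truncation\<close>

definition trunc_log :: "real \<Rightarrow> real \<Rightarrow> real \<Rightarrow> real" where
  "trunc_log \<epsilon> M z = ln (z\<^sup>2 + M\<^sup>2) / 2 - ln (z\<^sup>2 + \<epsilon>\<^sup>2) / 2"

text \<open>The truncated logarithm collects the Poisson scales in \<open>{\<epsilon>..M}\<close>,
  each with nonnegative energy. Keep only the scales in \<open>{1..2}\<close>, an interval of length
  1, and use that the energy decreases with the scale: the energy at scale 2 remains. As this bound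
  contains neither \<open>\<epsilon>\<close> nor \<open>M\<close>, it survives both limits.\<close>

lemma diff_energy_trunc_log_ge:
  assumes fin: "finite_borel_measure \<mu>" "finite_borel_measure \<nu>" and "0 < \<epsilon>" "\<epsilon> \<le> 1" "2 \<le> M"
  shows "diff_energy \<mu> \<nu> (\<lambda>z. 2 / (z\<^sup>2 + 2\<^sup>2)) \<le> diff_energy \<mu> \<nu> (trunc_log \<epsilon> M)"
proof -
  define N where "N = restrict_space lborel {\<epsilon>..M}"
  define H where "H s = diff_energy \<mu> \<nu> (\<lambda>z. s / (z\<^sup>2 + s\<^sup>2))" for s
  have space_N: "space N = {\<epsilon>..M}" by (simp add: N_def space_restrict_space)
  interpret N: finite_measure N
    by (rule finite_measureI)
       (use assms in \<open>simp add: N_def space_restrict_space emeasure_restrict_space\<close>)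
  have bound: "\<bar>s / (z\<^sup>2 + s\<^sup>2)\<bar> \<le> 1 / \<epsilon>" if "s \<in> space N" for s z
  proof -
    have s: "\<epsilon> \<le> s" "0 < s" using that assms by (auto simp: space_N)
    have "s / (z\<^sup>2 + s\<^sup>2) \<le> s / s\<^sup>2" using s by (intro divide_left_mono) (auto intro!: mult_pos_pos add_nonneg_pos)
    also have "\<dots> \<le> 1 / \<epsilon>" using s assms by (simp add: power2_eq_square frac_le)
    finally show ?thesis using s by simp
  qed
  have meas: "(\<lambda>(s, z::real). s / (z\<^sup>2 + s\<^sup>2)) \<in> borel_measurable (N \<Otimes>\<^sub>M borel)"
  proof -
    have [measurable]: "(\<lambda>s. s) \<in> borel_measurable N"
      unfolding N_def by (rule measurable_restrict_space1) simp
    show ?thesis by measurable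
  qed
  note mix = diff_energy_mixture[OF fin N.finite_measure_axioms meas bound]
  have "indicat_real {\<epsilon>..M} s * (indicat_real {1..2} s * H 2) = indicat_real {1..2} s * H 2" for s
    using assms by (auto split: split_indicator)
  note ind = this
  have "H 2 = (\<integral>s. indicator {1..2} s *\<^sub>R H 2 \<partial>N)"
    unfolding N_def by (subst integral_restrict_space) (simp_all add: ind)
  also have "\<dots> \<le> (\<integral>s. H s \<partial>N)"
  proof (rule integral_mono)
    show "integrable N (\<lambda>s. indicator {1..2} s *\<^sub>R H 2)"
      by (rule N.integrable_const_bound[where B = "\<bar>H 2\<bar>"]) (auto simp: N_def split: split_indicator intro!: measurable_restrict_space1)
    show "integrable N H" using mix(1) by (simp add: H_def[abs_def])
    show "indicator {1..2} s *\<^sub>R H 2 \<le> H s" if "s \<in> space N" for s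
    proof -
      have "0 \<le> H s"
        using that assms unfolding space_N H_def by (intro diff_energy_poisson_nonneg fin) auto
      moreover have "H 2 \<le> H s" if "1 \<le> s" "s \<le> 2"
        using that unfolding H_def by (intro diff_energy_poisson_antimono fin) auto
      ultimately show ?thesis by (auto split: split_indicator)
    qed
  qed
  also have "\<dots> = diff_energy \<mu> \<nu> (trunc_log \<epsilon> M)"
    using mix(2) integral_poisson_over_scale[of \<epsilon> M] assms
    by (simp add: N_def trunc_log_def[abs_def] H_def)
  finally show ?thesis by (simp add: H_def)
qed

lemma trunc_log_bounds:
  assumes "0 < \<epsilon>" "\<epsilon> \<le> M"
  shows "0 \<le> trunc_log \<epsilon> M z" "trunc_log \<epsilon> M z \<le> ln (M / \<epsilon>)"
proof -
  have p: "z\<^sup>2 + \<epsilon>\<^sup>2 > 0" "z\<^sup>2 + M\<^sup>2 > 0" using assms by (auto intro!: add_nonneg_pos)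
  have le: "\<epsilon>\<^sup>2 \<le> M\<^sup>2" using assms by (intro power_mono) auto
  with p show "0 \<le> trunc_log \<epsilon> M z" by (simp add: trunc_log_def)
  have "(z\<^sup>2 + M\<^sup>2) / (z\<^sup>2 + \<epsilon>\<^sup>2) \<le> (M / \<epsilon>)\<^sup>2"
    using p assms le by (simp add: power_divide divide_simps) (simp add: algebra_simps mult_mono le)
  then have "ln ((z\<^sup>2 + M\<^sup>2) / (z\<^sup>2 + \<epsilon>\<^sup>2)) \<le> ln ((M / \<epsilon>)\<^sup>2)"
    using p assms by (subst ln_le_cancel_iff) auto
  then show "trunc_log \<epsilon> M z \<le> ln (M / \<epsilon>)"
    using p assms by (simp add: trunc_log_def ln_div ln_realpow)
qed

lemma trunc_log_measurable [measurable]: "trunc_log \<epsilon> M \<in> borel_measurable borel"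
  unfolding trunc_log_def[abs_def] by measurable

lemma nn_mutual_integral:
  assumes "finite_borel_measure \<mu>" "finite_borel_measure \<nu>"
    and [measurable]: "f \<in> borel_measurable borel" and f: "\<And>z. 0 \<le> f z" "\<And>z. f z \<le> C"
  shows "(\<integral>\<^sup>+x. \<integral>\<^sup>+y. ennreal (f (x - y)) \<partial>\<nu> \<partial>\<mu>) = ennreal (mutual_integral \<mu> \<nu> f)"
proof -
  interpret M: finite_borel_measure \<mu> by fact
  interpret V: finite_borel_measure \<nu> by fact
  have [measurable_cong]: "sets \<mu> = sets borel" "sets \<nu> = sets borel"
    by (simp_all add: M.M_is_borel V.M_is_borel)
  have i: "integrable \<nu> (\<lambda>y. f (x - y))" for x
    by (rule V.integrable_const_bound[where B = C]) (auto simp: f)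
  have *: "(\<integral>\<^sup>+y. ennreal (f (x - y)) \<partial>\<nu>) = ennreal (\<integral>y. f (x - y) \<partial>\<nu>)" for x
    by (rule nn_integral_eq_integral[OF i]) (simp add: f)
  have b: "(\<integral>y. f (x - y) \<partial>\<nu>) \<le> (\<integral>y. C \<partial>\<nu>)" for x
    by (rule integral_mono[OF i]) (auto simp: f)
  have n: "0 \<le> (\<integral>y. f (x - y) \<partial>\<nu>)" for x by (simp add: f)
  have "integrable \<mu> (\<lambda>x. \<integral>y. f (x - y) \<partial>\<nu>)"
    by (rule M.integrable_const_bound[where B = "\<integral>y. C \<partial>\<nu>"]) (use b n in auto)
  then show ?thesis
    unfolding * mutual_integral_def by (rule nn_integral_eq_integral) (simp add: n)
qed

text \<open>
  The limit of \<^const>\<open>trunc_log\<close> as \<open>\<epsilon> \<rightarrow> 0\<close>. Unlike \<open>- ln \<bar>z\<bar>\<close> it is nonnegative everywhere, so that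
  iterated integrals need no integrability conditions.
\<close>

definition full_log :: "real \<Rightarrow> real \<Rightarrow> ennreal" where
  "full_log M z = (if z = 0 then \<infinity> else ennreal (ln (z\<^sup>2 + M\<^sup>2) / 2 - ln \<bar>z\<bar>))"

lemma full_log_measurable [measurable]: "full_log M \<in> borel_measurable borel"
  unfolding full_log_def[abs_def] by measurable

lemma trunc_log_mono:
  assumes "0 < \<epsilon>" "\<epsilon> \<le> \<epsilon>'"
  shows "trunc_log \<epsilon>' M z \<le> trunc_log \<epsilon> M z"
proof -
  have "0 < z\<^sup>2 + \<epsilon>\<^sup>2" using assms by (auto intro!: add_nonneg_pos)
  moreover have "\<epsilon>\<^sup>2 \<le> \<epsilon>'\<^sup>2" using assms by (intro power_mono) auto
  ultimately show ?thesis by (simp add: trunc_log_def)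
qed

lemma trunc_log_tendsto:
  assumes "M \<ge> 1"
  shows "(\<lambda>n. ennreal (trunc_log (1 / real (Suc n)) M z)) \<longlonglongrightarrow> full_log M z"
proof (cases "z = 0")
  case True
  have "filterlim (\<lambda>n. trunc_log (1 / real (Suc n)) M 0) at_top sequentially"
    using assms unfolding trunc_log_def by real_asymp
  then show ?thesis using True by (simp add: full_log_def infinity_ennreal_def ennreal_tendsto_top_eq_at_top)
next
  case False
  have "(\<lambda>n. trunc_log (1 / real (Suc n)) M z) \<longlonglongrightarrow> ln (z\<^sup>2 + M\<^sup>2) / 2 - ln (z\<^sup>2 + 0\<^sup>2) / 2"
    unfolding trunc_log_def using False 
    by (intro tendsto_intros LIMSEQ_Suc[OF lim_1_over_n]) auto
  moreover have "ln (z\<^sup>2) / 2 = ln \<bar>z\<bar>"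
    using False ln_realpow[of "\<bar>z\<bar>" 2] by simp
  ultimately show ?thesis using False by (simp add: full_log_def)
qed

definition nn_energy :: "real \<Rightarrow> real measure \<Rightarrow> real measure \<Rightarrow> ennreal" where
  "nn_energy M \<mu> \<nu> = (\<integral>\<^sup>+x. \<integral>\<^sup>+y. full_log M (x - y) \<partial>\<nu> \<partial>\<mu>)"

text \<open>Monotone convergence in the inner and in the outer integral, since
  \<open>trunc_log\<close> grows as its first parameter shrinks. The limit may be infinite, hence
  the formulation in \<open>ennreal\<close>.\<close>

lemma mutual_integral_trunc_log_tendsto:
  assumes "finite_borel_measure \<mu>" "finite_borel_measure \<nu>" "M \<ge> 1"
  shows "(\<lambda>n. ennreal (mutual_integral \<mu> \<nu> (trunc_log (1 / real (Suc n)) M))) \<longlonglongrightarrow> nn_energy M \<mu> \<nu>"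
proof -
  interpret M: finite_borel_measure \<mu> by fact
  interpret V: finite_borel_measure \<nu> by fact
  have [measurable_cong]: "sets \<mu> = sets borel" "sets \<nu> = sets borel"
    by (simp_all add: M.M_is_borel V.M_is_borel)
  have le: "1 / real (Suc n) \<le> M" for n
    using assms(3) by (intro order_trans[of "1 / real (Suc n)" 1 M]) auto
  have mono: "incseq (\<lambda>n. ennreal (trunc_log (1 / real (Suc n)) M z))" for z
    by (rule incseq_SucI) (auto intro!: ennreal_leI trunc_log_mono frac_le)
  have "(\<lambda>n. \<integral>\<^sup>+x. \<integral>\<^sup>+y. ennreal (trunc_log (1 / real (Suc n)) M (x - y)) \<partial>\<nu> \<partial>\<mu>) \<longlonglongrightarrow> nn_energy M \<mu> \<nu>"
    unfolding nn_energy_def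
  proof (rule nn_integral_LIMSEQ)
    show "incseq (\<lambda>n x. \<integral>\<^sup>+y. ennreal (trunc_log (1 / real (Suc n)) M (x - y)) \<partial>\<nu>)"
      using mono by (auto simp: incseq_def le_fun_def intro!: nn_integral_mono)
    show "(\<lambda>n. \<integral>\<^sup>+y. ennreal (trunc_log (1 / real (Suc n)) M (x - y)) \<partial>\<nu>)
        \<longlonglongrightarrow> (\<integral>\<^sup>+y. full_log M (x - y) \<partial>\<nu>)" for x
      by (rule nn_integral_LIMSEQ)
         (use mono in \<open>auto simp: incseq_def le_fun_def intro!: trunc_log_tendsto assms simp del: of_nat_Suc\<close>)
  qed auto
  moreover have "(\<integral>\<^sup>+x. \<integral>\<^sup>+y. ennreal (trunc_log (1 / real (Suc n)) M (x - y)) \<partial>\<nu> \<partial>\<mu>)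
      = ennreal (mutual_integral \<mu> \<nu> (trunc_log (1 / real (Suc n)) M))" for n
    by (rule nn_mutual_integral[OF assms(1,2)]) (use le in \<open>auto intro!: trunc_log_bounds simp del: of_nat_Suc\<close>)
  ultimately show ?thesis by simp
qed

lemma mutual_integral_nonneg:
  assumes "\<And>z. 0 \<le> f z"
  shows "0 \<le> mutual_integral \<mu> \<nu> f"
  unfolding mutual_integral_def by (simp add: assms)

text \<open>Positivity of the energy of \<open>\<mu> - \<nu>\<close>, with the mixed terms moved to
  the left. Nothing is subtracted, so each term can pass to its limit separately even if that limit
  is infinite.\<close>

lemma nn_energy_ge:
  assumes fin: "finite_borel_measure \<mu>" "finite_borel_measure \<nu>" and "2 \<le> M"
  shows "nn_energy M \<mu> \<nu> + nn_energy M \<nu> \<mu> + ennreal (diff_energy \<mu> \<nu> (\<lambda>z. 2 / (z\<^sup>2 + 2\<^sup>2)))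
    \<le> nn_energy M \<mu> \<mu> + nn_energy M \<nu> \<nu>"
proof -
  define D where "D = diff_energy \<mu> \<nu> (\<lambda>z. 2 / (z\<^sup>2 + 2\<^sup>2))"
  have "D \<ge> 0" unfolding D_def using diff_energy_poisson_nonneg[OF fin, of 2] by simp
  have "M \<ge> 1" using assms by simp
  note lim = mutual_integral_trunc_log_tendsto[OF _ _ \<open>M \<ge> 1\<close>]
  show ?thesis
    unfolding D_def[symmetric]
  proof (rule LIMSEQ_le)
    show "(\<lambda>n. ennreal (mutual_integral \<mu> \<nu> (trunc_log (1 / real (Suc n)) M))
      + ennreal (mutual_integral \<nu> \<mu> (trunc_log (1 / real (Suc n)) M)) + ennreal D)
      \<longlonglongrightarrow> nn_energy M \<mu> \<nu> + nn_energy M \<nu> \<mu> + ennreal D"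
      by (intro tendsto_add tendsto_const lim fin)
    show "(\<lambda>n. ennreal (mutual_integral \<mu> \<mu> (trunc_log (1 / real (Suc n)) M))
      + ennreal (mutual_integral \<nu> \<nu> (trunc_log (1 / real (Suc n)) M)))
      \<longlonglongrightarrow> nn_energy M \<mu> \<mu> + nn_energy M \<nu> \<nu>"
      by (intro tendsto_add tendsto_const lim fin)
    have "ennreal (mutual_integral \<mu> \<nu> (trunc_log \<epsilon> M)) + ennreal (mutual_integral \<nu> \<mu> (trunc_log \<epsilon> M)) + ennreal D
      \<le> ennreal (mutual_integral \<mu> \<mu> (trunc_log \<epsilon> M)) + ennreal (mutual_integral \<nu> \<nu> (trunc_log \<epsilon> M))"
      if \<epsilon>: "0 < \<epsilon>" "\<epsilon> \<le> 1" for \<epsilon>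
    proof -
      have nn: "0 \<le> mutual_integral \<mu>' \<nu>' (trunc_log \<epsilon> M)" for \<mu>' \<nu>'
        using \<epsilon> \<open>M \<ge> 1\<close> by (intro mutual_integral_nonneg trunc_log_bounds) auto
      show ?thesis
        using diff_energy_trunc_log_ge[OF fin \<epsilon> \<open>2 \<le> M\<close>] nn \<open>D \<ge> 0\<close>
        by (simp add: D_def diff_energy_def flip: ennreal_plus)
    qed
    then show "\<exists>N. \<forall>n\<ge>N. ennreal (mutual_integral \<mu> \<nu> (trunc_log (1 / real (Suc n)) M))
      + ennreal (mutual_integral \<nu> \<mu> (trunc_log (1 / real (Suc n)) M)) + ennreal D
      \<le> ennreal (mutual_integral \<mu> \<mu> (trunc_log (1 / real (Suc n)) M))
      + ennreal (mutual_integral \<nu> \<nu> (trunc_log (1 / real (Suc n)) M))"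
      by (intro exI[of _ 0] allI impI) (simp del: of_nat_Suc)
  qed
qed

section \<open>Recovering a measure from its characteristic function on the positive
  half-line\<close>

lemma real_distribution_scale:
  assumes "finite_borel_measure \<mu>" "emeasure \<mu> UNIV = ennreal t" "t > 0"
  shows "real_distribution (scale_measure (ennreal (1 / t)) \<mu>)"
proof -
  interpret finite_borel_measure \<mu> by fact
  have "space \<mu> = UNIV" using sets_eq_imp_space_eq[OF M_is_borel] by simp
  show ?thesis
    by (rule real_distribution.intro, rule prob_spaceI)
       (use assms M_is_borel \<open>space \<mu> = UNIV\<close> in \<open>auto simp: real_distribution_axioms_def space_scale_measure simp flip: ennreal_mult\<close>)
qed

lemma char_scale_measure:
  assumes "finite_borel_measure \<mu>" "0 \<le> r"
  shows "char (scale_measure (ennreal r) \<mu>) \<xi> = r *\<^sub>R char \<mu> \<xi>"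
proof -
  interpret finite_borel_measure \<mu> by fact
  have [measurable_cong]: "sets \<mu> = sets borel" by (rule M_is_borel)
  have "scale_measure (ennreal r) \<mu> = density \<mu> (\<lambda>_. ennreal r)"
    by (rule measure_eqI) (auto simp: emeasure_density nn_integral_cmult_indicator)
  then show ?thesis
    using assms unfolding char_def by (subst \<open>scale_measure _ _ = _\<close>, subst integral_density) auto
qed

text \<open>Agreement almost everywhere suffices: characteristic functions are continuous, so the
  set of disagreement is open, and an open null set is empty. Negative frequencies follow by
  conjugation, and scaling by \<open>1 / t\<close> makes Levy's uniqueness theorem for probability
  measures applicable.\<close>

lemma finite_borel_measure_eqI_char:
  assumes fin: "finite_borel_measure \<mu>" "finite_borel_measure \<nu>"
    and mass: "emeasure \<mu> UNIV = ennreal t" "emeasure \<nu> UNIV = ennreal t" "t > 0"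
    and ae: "AE \<xi> in lborel. \<xi> > 0 \<longrightarrow> char \<mu> \<xi> = char \<nu> \<xi>"
  shows "\<mu> = \<nu>"
proof -
  let ?s = "scale_measure (ennreal (1 / t))"
  interpret M: real_distribution "?s \<mu>" by (rule real_distribution_scale) fact+
  interpret V: real_distribution "?s \<nu>" by (rule real_distribution_scale) fact+
  have sc: "char (?s \<mu>) \<xi> = (1 / t) *\<^sub>R char \<mu> \<xi>" "char (?s \<nu>) \<xi> = (1 / t) *\<^sub>R char \<nu> \<xi>" for \<xi>
    using mass by (auto intro!: char_scale_measure fin)
  define U where "U = {0<..} \<inter> {\<xi>. char (?s \<mu>) \<xi> \<noteq> char (?s \<nu>) \<xi>}"
  have "open U" unfolding U_def
    by (intro open_Int open_Collect_neq continuous_at_imp_continuous_on ballI M.isCont_char V.isCont_char) auto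
  have "AE \<xi> in lborel. \<xi> \<notin> U"
    using ae by eventually_elim (auto simp: U_def sc)
  then have "U \<in> null_sets lborel"
    using \<open>open U\<close> by (subst AE_iff_null_sets) auto
  then have "U = {}"
    using null_sets_completionI[OF \<open>U \<in> null_sets lborel\<close>] open_not_negligible[OF \<open>open U\<close>]
    by (auto simp: negligible_iff_null_sets)
  have pos: "char (?s \<mu>) \<xi> = char (?s \<nu>) \<xi>" if "\<xi> > 0" for \<xi>
    using \<open>U = {}\<close> that by (auto simp: U_def)
  have neg: "char M' (- \<xi>) = cnj (char M' \<xi>)" for M' \<xi>
  proof -
    have "cnj (char M' \<xi>) = (CLINT x|M'. cnj (iexp (\<xi> * x)))"
      unfolding char_def by (rule Bochner_Integration.integral_cnj[symmetric])
    also have "(\<lambda>x. cnj (iexp (\<xi> * x))) = (\<lambda>x. iexp (- \<xi> * x))" by (simp add: exp_cnj)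
    finally show ?thesis by (simp add: char_def)
  qed
  have "char (?s \<mu>) = char (?s \<nu>)"
  proof
    fix \<xi> :: real
    consider "\<xi> > 0" | "\<xi> = 0" | "- \<xi> > 0" by linarith
    then show "char (?s \<mu>) \<xi> = char (?s \<nu>) \<xi>"
    proof cases
      case 3
      then show ?thesis using pos[OF 3] by (simp add: neg)
    qed (use pos M.char_zero V.char_zero in auto)
  qed
  then have eq: "?s \<mu> = ?s \<nu>"
    by (intro Levy_uniqueness) unfold_locales
  have "scale_measure (ennreal t) (?s M') = M'" for M' :: "real measure"
    using mass by (simp add: scale_scale_measure flip: ennreal_mult)
  then show ?thesis using eq by metis
qed

text \<open>A single scale is enough because its Fourier weight \<open>exp (- (\<xi> * 2))\<close>
  vanishes nowhere.\<close>

lemma eq_if_diff_energy_poisson_0: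
  assumes fin: "finite_borel_measure \<mu>" "finite_borel_measure \<nu>"
    and mass: "emeasure \<mu> UNIV = ennreal t" "emeasure \<nu> UNIV = ennreal t" "t > 0"
    and 0: "diff_energy \<mu> \<nu> (\<lambda>z. 2 / (z\<^sup>2 + 2\<^sup>2)) \<le> 0"
  shows "\<mu> = \<nu>"
proof (rule finite_borel_measure_eqI_char[OF fin mass])
  have "(0::real) < 2" by simp
  note p = diff_energy_poisson[OF fin this]
  have "diff_energy \<mu> \<nu> (\<lambda>z. 2 / (z\<^sup>2 + 2\<^sup>2)) = 0"
    using 0 diff_energy_poisson_nonneg[OF fin, of 2] by simp
  then have "AE \<xi> in lborel. indicator {0<..} \<xi> *\<^sub>R (exp (- (\<xi> * 2)) * (cmod (char \<mu> \<xi> - char \<nu> \<xi>))\<^sup>2) = 0"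
    unfolding p(2) by (subst (asm) integral_nonneg_eq_0_iff_AE[OF p(1)]) auto
  then show "AE \<xi> in lborel. \<xi> > 0 \<longrightarrow> char \<mu> \<xi> = char \<nu> \<xi>"
    by eventually_elim auto
qed

section \<open>Supports, potentials and the comparison of two equilibrium measures\<close>

lemma emeasure_compl_measure_support:
  assumes "sets \<nu> = sets borel"
  shows "emeasure \<nu> (- measure_support \<nu>) = 0"
proof -
  \<comment> \<open>The complement is a union of possibly uncountably many open null sets;
    Lindelof's theorem replaces it by a countable union.\<close>
  obtain \<U> where U: "\<U> \<subseteq> {U. open U \<and> emeasure \<nu> U = 0}" "countable \<U>" "\<Union>\<U> = \<Union>{U. open U \<and> emeasure \<nu> U = 0}"
    by (rule Lindelof[of "{U. open U \<and> emeasure \<nu> U = 0}"]) auto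
  have "(\<Union>U\<in>\<U>. U) \<in> null_sets \<nu>"
    using U assms by (intro null_sets_UN') (auto intro!: null_setsI)
  moreover have "- measure_support \<nu> = \<Union>{U. open U \<and> emeasure \<nu> U = 0}"
    by (auto simp: measure_support_def zero_less_iff_neq_zero)
  ultimately show ?thesis using U by (simp add: null_setsD1)
qed

text \<open>The bridge between the signed \<open>ereal\<close> potential of the definition and the
  nonnegative kernel: the two kernels differ by a smooth function that \<open>\<mu>\<close>
  integrates.\<close>

lemma log_potential_full_log:
  assumes "finite_borel_measure \<mu>" and "M \<ge> 1"
    and int: "integrable \<mu> (\<lambda>y. ln ((x - y)\<^sup>2 + M\<^sup>2) / 2)"
  shows "enn2ereal (\<integral>\<^sup>+y. full_log M (x - y) \<partial>\<mu>)
    = log_potential \<mu> x + ereal (\<integral>y. ln ((x - y)\<^sup>2 + M\<^sup>2) / 2 \<partial>\<mu>)"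
proof -
  interpret finite_borel_measure \<mu> by fact
  have [measurable_cong]: "sets \<mu> = sets borel" by (rule M_is_borel)
  define L where "L y = ln ((x - y)\<^sup>2 + M\<^sup>2) / 2" for y
  have L: "0 \<le> L y" "ln \<bar>x - y\<bar> \<le> L y" for y
  proof -
    have *: "1 \<le> M\<^sup>2" using assms(2) by simp
    then have "1 \<le> (x - y)\<^sup>2 + M\<^sup>2" by (smt (verit) zero_le_power2)
    then show "0 \<le> L y" by (simp add: L_def)
    show "ln \<bar>x - y\<bar> \<le> L y"
    proof (cases "x = y")
      case False
      have "2 * ln \<bar>x - y\<bar> = ln ((x - y)\<^sup>2)" using False ln_realpow[of "\<bar>x - y\<bar>" 2] by simp
      also have "\<dots> \<le> ln ((x - y)\<^sup>2 + M\<^sup>2)" using False * by (subst ln_le_cancel_iff) (auto simp: add_pos_nonneg)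
      finally show ?thesis by (simp add: L_def)
    qed (use \<open>0 \<le> L y\<close> in simp)
  qed
  have [measurable]: "(\<lambda>y. e2ennreal (log_kernel x y)) \<in> borel_measurable borel"
      "(\<lambda>y. e2ennreal (- log_kernel x y)) \<in> borel_measurable borel" "L \<in> borel_measurable borel"
    unfolding log_kernel_def L_def by measurable
  define A B C where "A = (\<integral>\<^sup>+y. full_log M (x - y) \<partial>\<mu>)" and "B = (\<integral>\<^sup>+y. e2ennreal (- log_kernel x y) \<partial>\<mu>)"
    and "C = (\<integral>\<^sup>+y. e2ennreal (log_kernel x y) \<partial>\<mu>)"
  have iL: "(\<integral>\<^sup>+y. ennreal (L y) \<partial>\<mu>) = ennreal (\<integral>y. L y \<partial>\<mu>)"
    using int L by (intro nn_integral_eq_integral) (auto simp: L_def)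
  have L0: "0 \<le> (\<integral>y. L y \<partial>\<mu>)" by (simp add: L)
  \<comment> \<open>The negative part of the kernel is dominated by \<open>L\<close>, so
    \<open>B\<close> is finite and can be cancelled; \<open>C\<close> may be infinite.\<close>
  have "B \<le> (\<integral>\<^sup>+y. ennreal (L y) \<partial>\<mu>)"
    unfolding B_def using L
    by (intro nn_integral_mono) (auto simp: log_kernel_def e2ennreal_neg ennreal_leI ennreal.abs_eq[symmetric] simp flip: ennreal.rep_eq)
  then obtain b where b: "B = ennreal b" "b \<ge> 0"
    unfolding iL by (cases B) (auto simp: top_unique)
  \<comment> \<open>Written with sums only, the identity holds in \<open>ennreal\<close> also on the
    diagonal, where both sides are infinite.\<close>
  have "full_log M (x - y) + e2ennreal (- log_kernel x y) = e2ennreal (log_kernel x y) + ennreal (L y)" for y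
  proof (cases "x = y")
    case False
    then show ?thesis
      using L[of y] by (cases "0 \<le> ln \<bar>x - y\<bar>")
        (auto simp: full_log_def log_kernel_def L_def ennreal_neg ennreal_def[symmetric] simp flip: ennreal_plus)
  qed (simp add: full_log_def log_kernel_def e2ennreal_infty)
  then have "A + B = C + ennreal (\<integral>y. L y \<partial>\<mu>)"
    unfolding A_def B_def C_def iL[symmetric] by (subst (1 2) nn_integral_add[symmetric]) auto
  then have "enn2ereal A + ereal b = enn2ereal C + ereal (\<integral>y. L y \<partial>\<mu>)"
    using b L0 by (metis enn2ereal_ennreal plus_ennreal.rep_eq)
  moreover have "log_potential \<mu> x = enn2ereal C - ereal b"
    using b by (simp add: log_potential_def B_def C_def)
  ultimately show ?thesis unfolding A_def[symmetric] L_def[symmetric]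
    by (cases "enn2ereal A"; cases "enn2ereal C") auto
qed

text \<open>On bounded sets \<open>ln ((x - y)\<^sup>2 + M\<^sup>2) / 2\<close> is
  \<open>ln M\<close> up to order \<open>1 / M\<^sup>2\<close>, so the cutoff nearly shifts the
  potential by the constant \<open>t * ln M\<close>. Only the upper bound carries an error term, as
  \<open>ln M\<close> itself is a lower bound.\<close>

lemma nn_potential_bounds:
  assumes fin: "finite_borel_measure \<mu>" and mass: "measure \<mu> UNIV = t"
    and supp: "AE y in \<mu>. \<bar>y\<bar> \<le> R" and "\<bar>x\<bar> \<le> R" and "M \<ge> 1"
  shows "log_potential \<mu> x = ereal v \<Longrightarrow>
      (\<integral>\<^sup>+y. full_log M (x - y) \<partial>\<mu>) \<le> ennreal (v + t * (ln M + 2 * R\<^sup>2 / M\<^sup>2))"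
    and "log_potential \<mu> x \<ge> ereal v \<Longrightarrow>
      ennreal (v + t * ln M) \<le> (\<integral>\<^sup>+y. full_log M (x - y) \<partial>\<mu>)"
proof -
  interpret finite_borel_measure \<mu> by fact
  have [measurable_cong]: "sets \<mu> = sets borel" by (rule M_is_borel)
  have "space \<mu> = UNIV" using sets_eq_imp_space_eq[OF M_is_borel] by simp
  define L where "L y = ln ((x - y)\<^sup>2 + M\<^sup>2) / 2" for y
  have [measurable]: "L \<in> borel_measurable borel" unfolding L_def by measurable
  have lower: "ln M \<le> L y" for y
  proof -
    have "2 * ln M = ln (M\<^sup>2)" using assms(5) by (simp add: ln_realpow)
    also have "\<dots> \<le> ln ((x - y)\<^sup>2 + M\<^sup>2)"
      using assms(5) by (subst ln_le_cancel_iff) (auto simp: add_nonneg_pos)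
    finally show ?thesis by (simp add: L_def)
  qed
  \<comment> \<open>The error comes from \<open>ln (1 + u) \<le> u\<close> and
    \<open>\<bar>x - y\<bar> \<le> 2 * R\<close>, which give
    \<open>(2 * R)\<^sup>2 / (2 * M\<^sup>2)\<close>.\<close>
  have upper: "L y \<le> ln M + 2 * R\<^sup>2 / M\<^sup>2" if "\<bar>y\<bar> \<le> R" for y
  proof -
    have "(x - y)\<^sup>2 + M\<^sup>2 = M\<^sup>2 * (1 + (x - y)\<^sup>2 / M\<^sup>2)" using assms(5) by (simp add: algebra_simps)
    moreover have "1 + (x - y)\<^sup>2 / M\<^sup>2 > 0" by (simp add: add_pos_nonneg)
    ultimately have "ln ((x - y)\<^sup>2 + M\<^sup>2) = 2 * ln M + ln (1 + (x - y)\<^sup>2 / M\<^sup>2)"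
      using assms(5) by (simp add: ln_mult ln_realpow)
    also have "ln (1 + (x - y)\<^sup>2 / M\<^sup>2) \<le> (x - y)\<^sup>2 / M\<^sup>2" by (rule ln_add_one_self_le_self) simp
    also have "(x - y)\<^sup>2 \<le> (2 * R)\<^sup>2" using that assms(4) by (intro power2_le_iff_abs_le[THEN iffD2]) auto
    finally show ?thesis using assms(5) by (simp add: L_def divide_right_mono power_mult_distrib)
  qed
  have "\<bar>L y\<bar> \<le> ln M + 2 * R\<^sup>2 / M\<^sup>2" if "\<bar>y\<bar> \<le> R" for y
    using upper[OF that] lower[of y] ln_ge_zero[OF assms(5)] by linarith
  then have int: "integrable \<mu> L"
    using supp by (intro integrable_const_bound[where B = "ln M + 2 * R\<^sup>2 / M\<^sup>2"])
      (auto elim!: eventually_mono)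
  have "(\<integral>y. ln M \<partial>\<mu>) \<le> (\<integral>y. L y \<partial>\<mu>)" by (rule integral_mono) (auto intro: int lower)
  then have l: "t * ln M \<le> (\<integral>y. L y \<partial>\<mu>)" using mass \<open>space \<mu> = UNIV\<close> by simp
  have "(\<integral>y. L y \<partial>\<mu>) \<le> (\<integral>y. ln M + 2 * R\<^sup>2 / M\<^sup>2 \<partial>\<mu>)"
    by (rule integral_mono_AE) (use supp in \<open>auto elim!: eventually_mono intro: int upper\<close>)
  then have u: "(\<integral>y. L y \<partial>\<mu>) \<le> t * (ln M + 2 * R\<^sup>2 / M\<^sup>2)" using mass \<open>space \<mu> = UNIV\<close> by simp
  have eq: "enn2ereal (\<integral>\<^sup>+y. full_log M (x - y) \<partial>\<mu>) = log_potential \<mu> x + ereal (\<integral>y. L y \<partial>\<mu>)"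
    using log_potential_full_log[OF fin assms(5)] int by (simp add: L_def[abs_def])
  show "(\<integral>\<^sup>+y. full_log M (x - y) \<partial>\<mu>) \<le> ennreal (v + t * (ln M + 2 * R\<^sup>2 / M\<^sup>2))" if "log_potential \<mu> x = ereal v"
  proof -
    have "enn2ereal (\<integral>\<^sup>+y. full_log M (x - y) \<partial>\<mu>) = ereal (v + (\<integral>y. L y \<partial>\<mu>))"
      using eq that by simp
    then have "(\<integral>\<^sup>+y. full_log M (x - y) \<partial>\<mu>) = ennreal (v + (\<integral>y. L y \<partial>\<mu>))"
      by (metis e2ennreal_enn2ereal e2ennreal_ereal)
    then show ?thesis using u by (simp add: ennreal_leI)
  qed
  show "ennreal (v + t * ln M) \<le> (\<integral>\<^sup>+y. full_log M (x - y) \<partial>\<mu>)" if "log_potential \<mu> x \<ge> ereal v"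
  proof -
    have "ereal (v + t * ln M) \<le> enn2ereal (\<integral>\<^sup>+y. full_log M (x - y) \<partial>\<mu>)"
      unfolding eq using that l by (cases "log_potential \<mu> x") auto
    then have "e2ennreal (ereal (v + t * ln M)) \<le> e2ennreal (enn2ereal (\<integral>\<^sup>+y. full_log M (x - y) \<partial>\<mu>))"
      by (rule e2ennreal_mono)
    then show ?thesis by simp
  qed
qed

lemma is_equilibrium_measureD:
  assumes "is_equilibrium_measure \<Sigma> \<phi> t \<mu>" "\<Sigma> \<in> sets borel" "t > 0"
  shows "finite_borel_measure \<mu>" "emeasure \<mu> UNIV = ennreal t" "AE x in \<mu>. x \<in> measure_support \<mu>"
proof -
  have sets: "sets \<mu> = sets borel" and mass: "emeasure \<mu> \<Sigma> = ennreal t"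
    and supp: "measure_support \<mu> \<subseteq> \<Sigma>" and cpt: "compact (measure_support \<mu>)"
    using assms by (auto simp: is_equilibrium_measure_def)
  have space: "space \<mu> = UNIV" using sets_eq_imp_space_eq[OF sets] by simp
  have meas: "measure_support \<mu> \<in> sets \<mu>" using cpt sets by (simp add: compact_imp_closed)
  have null: "- measure_support \<mu> \<in> null_sets \<mu>"
    using sets.compl_sets[OF meas] space by (intro null_setsI emeasure_compl_measure_support sets) (auto simp: Compl_eq_Diff_UNIV)
  show ae: "AE x in \<mu>. x \<in> measure_support \<mu>"
    by (rule AE_I'[OF null]) auto
  have "emeasure \<mu> UNIV = emeasure \<mu> \<Sigma>"
    using ae supp assms(2) sets space by (intro emeasure_eq_AE) auto
  then show m: "emeasure \<mu> UNIV = ennreal t" using mass by simp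
  show "finite_borel_measure \<mu>"
    using m space sets by (intro finite_borel_measure.intro finite_measureI) (auto simp: finite_borel_measure_axioms_def)
qed

text \<open>Integrate the equality for each measure against itself and the inequality for each
  measure against the other. The field terms occur once on either side, and so do the constants
  \<open>c\<close> and \<open>d\<close> with the common factor \<open>t\<close>; hence everything
  cancels except the energy of the difference and an error that vanishes as \<open>M\<close>
  grows.\<close>

theorem equilibrium_measure_unique:
  assumes \<mu>: "is_equilibrium_measure \<Sigma> \<phi> t \<mu>" and \<nu>: "is_equilibrium_measure \<Sigma> \<phi> t \<nu>"
    and meas: "\<Sigma> \<in> sets borel" and cont: "continuous_on \<Sigma> \<phi>" and t: "t > 0"
  shows "\<mu> = \<nu>"
proof -
  note M = is_equilibrium_measureD[OF \<mu> meas t]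
  note V = is_equilibrium_measureD[OF \<nu> meas t]
  let ?K = "measure_support \<mu> \<union> measure_support \<nu>"
  have K: "compact ?K" "?K \<subseteq> \<Sigma>"
    using \<mu> \<nu> by (auto simp: is_equilibrium_measure_def)
  obtain R where R: "\<And>x. x \<in> ?K \<Longrightarrow> \<bar>x\<bar> \<le> R"
    using compact_imp_bounded[OF K(1)] by (auto simp: bounded_iff)
  have "compact (\<phi> ` ?K)"
    by (intro compact_continuous_image continuous_on_subset[OF cont] K)
  then obtain F where F: "\<And>x. x \<in> ?K \<Longrightarrow> \<bar>\<phi> x\<bar> \<le> F"
    using compact_imp_bounded by (fastforce simp: bounded_iff)
  \<comment> \<open>The field is controlled only on \<open>\<Sigma>\<close>; cutting it off outside
    the compact set \<open>?K\<close> makes it a bounded Borel function on the line.\<close>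
  have int: "integrable \<rho> (\<lambda>x. indicator ?K x * \<phi> x)"
    if "finite_borel_measure \<rho>" for \<rho>
  proof -
    interpret finite_borel_measure \<rho> by fact
    have "(\<lambda>x. indicator ?K x *\<^sub>R \<phi> x) \<in> borel_measurable borel"
      by (rule borel_measurable_continuous_on_indicator)
         (auto intro!: borel_closed compact_imp_closed K(1) continuous_on_subset[OF cont K(2)])
    then have [measurable]: "(\<lambda>x. indicator ?K x * \<phi> x) \<in> borel_measurable borel" by simp
    have [measurable_cong]: "sets \<rho> = sets borel" by (rule M_is_borel)
    have "\<bar>indicator ?K x * \<phi> x\<bar> \<le> max F 0" for x
      using F[of x] by (auto split: split_indicator)
    then show ?thesis by (intro integrable_const_bound[where B = "max F 0"]) auto
  qed
  define \<Phi> where "\<Phi> \<rho> = (\<integral>x. indicator ?K x * \<phi> x \<partial>\<rho>)" for \<rho>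
  define D where "D = diff_energy \<mu> \<nu> (\<lambda>z. 2 / (z\<^sup>2 + 2\<^sup>2))"
  define err where "err M = t * (2 * R\<^sup>2 / M\<^sup>2)" for M :: real
  obtain c where c: "\<And>x. x \<in> measure_support \<mu> \<Longrightarrow> log_potential \<mu> x + ereal (\<phi> x) = ereal c"
      "\<And>x. x \<in> \<Sigma> \<Longrightarrow> log_potential \<mu> x + ereal (\<phi> x) \<ge> ereal c"
    using \<mu> by (auto simp: is_equilibrium_measure_def)
  obtain d where d: "\<And>x. x \<in> measure_support \<nu> \<Longrightarrow> log_potential \<nu> x + ereal (\<phi> x) = ereal d"
      "\<And>x. x \<in> \<Sigma> \<Longrightarrow> log_potential \<nu> x + ereal (\<phi> x) \<ge> ereal d"
    using \<nu> by (auto simp: is_equilibrium_measure_def)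
  have eqD: "v = ereal (c - p)" if "v + ereal p = ereal c" for v c p
    using that by (cases v) auto
  have geD: "v \<ge> ereal (c - p)" if "v + ereal p \<ge> ereal c" for v c p
    using that by (cases v) auto
  \<comment> \<open>The condition \<open>a \<ge> F\<close> keeps \<open>a - \<phi> x\<close>
    nonnegative on \<open>?K\<close>, so that \<open>ennreal\<close> truncates nothing.\<close>
  have nn: "(\<integral>\<^sup>+x. ennreal (a - \<phi> x) \<partial>\<rho>) = ennreal (t * a - \<Phi> \<rho>)"
    if \<rho>: "finite_borel_measure \<rho>" "emeasure \<rho> UNIV = ennreal t" "AE x in \<rho>. x \<in> ?K" and "a \<ge> F" for \<rho> a
  proof -
    interpret finite_borel_measure \<rho> by fact
    have sp: "space \<rho> = UNIV" using sets_eq_imp_space_eq[OF M_is_borel] by simp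
    have *: "AE x in \<rho>. 0 \<le> a - indicator ?K x * \<phi> x"
      using \<rho>(3) by eventually_elim (use F \<open>a \<ge> F\<close> in fastforce)
    have "(\<integral>\<^sup>+x. ennreal (a - \<phi> x) \<partial>\<rho>) = (\<integral>\<^sup>+x. ennreal (a - indicator ?K x * \<phi> x) \<partial>\<rho>)"
      by (rule nn_integral_cong_AE) (use \<rho>(3) in eventually_elim, auto)
    also have "\<dots> = ennreal (\<integral>x. a - indicator ?K x * \<phi> x \<partial>\<rho>)"
      by (rule nn_integral_eq_integral[OF _ *]) (intro Bochner_Integration.integrable_diff int \<rho>(1) integrable_const)
    also have "(\<integral>x. a - indicator ?K x * \<phi> x \<partial>\<rho>) = t * a - \<Phi> \<rho>"
      unfolding \<Phi>_def using sp \<rho>(2) t by (subst Bochner_Integration.integral_diff) (auto intro!: int \<rho>(1) simp: measure_def)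
    finally show ?thesis .
  qed
  have measure: "measure \<mu> UNIV = t" "measure \<nu> UNIV = t"
    using M(2) V(2) t by (simp_all add: measure_def)
  have Kae: "AE x in \<mu>. x \<in> ?K" "AE x in \<nu>. x \<in> ?K" using M(3) V(3) by (auto elim!: eventually_mono)
  have Rae: "AE x in \<mu>. \<bar>x\<bar> \<le> R" "AE x in \<nu>. \<bar>x\<bar> \<le> R"
    using Kae by (auto elim!: eventually_mono intro: R)
  have "\<forall>\<^sub>F M in at_top. D \<le> 2 * t * err M"
  proof -
    \<comment> \<open>A large \<open>M\<close> lifts both constants above the bound \<open>F\<close>
      of the field, as the preceding integral formula demands.\<close>
    have "filterlim (\<lambda>M. c + t * ln M) at_top at_top" "filterlim (\<lambda>M. d + t * ln M) at_top at_top"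
      using t by real_asymp+
    then have ev: "\<forall>\<^sub>F M in at_top. c + t * ln M \<ge> F \<and> d + t * ln M \<ge> F \<and> (2::real) \<le> M"
      by (auto simp: filterlim_at_top intro!: eventually_conj eventually_ge_at_top)
    then show ?thesis
    proof eventually_elim
      case (elim M)
      then have "M \<ge> 1" by simp
      have e: "err M \<ge> 0" using t by (simp add: err_def)
      note bM = nn_potential_bounds[OF M(1) measure(1) Rae(1) _ \<open>M \<ge> 1\<close>]
      note bV = nn_potential_bounds[OF V(1) measure(2) Rae(2) _ \<open>M \<ge> 1\<close>]
      have "nn_energy M \<mu> \<mu> \<le> (\<integral>\<^sup>+x. ennreal ((c + t * ln M + err M) - \<phi> x) \<partial>\<mu>)"
        unfolding nn_energy_def
      proof (rule nn_integral_mono_AE, use M(3) in eventually_elim)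
        case (elim x)
        show ?case using bM(1)[OF R eqD[OF c(1)[OF elim]]] elim by (simp add: err_def algebra_simps)
      qed
      also have "\<dots> = ennreal (t * (c + t * ln M + err M) - \<Phi> \<mu>)"
        using elim e by (intro nn M Kae) auto
      finally have 1: "nn_energy M \<mu> \<mu> \<le> \<dots>" .
      have "nn_energy M \<nu> \<nu> \<le> (\<integral>\<^sup>+x. ennreal ((d + t * ln M + err M) - \<phi> x) \<partial>\<nu>)"
        unfolding nn_energy_def
      proof (rule nn_integral_mono_AE, use V(3) in eventually_elim)
        case (elim x)
        show ?case using bV(1)[OF R eqD[OF d(1)[OF elim]]] elim by (simp add: err_def algebra_simps)
      qed
      also have "\<dots> = ennreal (t * (d + t * ln M + err M) - \<Phi> \<nu>)"
        using elim e by (intro nn V Kae) auto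
      finally have 2: "nn_energy M \<nu> \<nu> \<le> \<dots>" .
      have "ennreal (t * (d + t * ln M) - \<Phi> \<mu>) = (\<integral>\<^sup>+x. ennreal ((d + t * ln M) - \<phi> x) \<partial>\<mu>)"
        using elim by (intro nn[symmetric] M Kae) auto
      also have "\<dots> \<le> nn_energy M \<mu> \<nu>"
        unfolding nn_energy_def
      proof (rule nn_integral_mono_AE, use Kae(1) in eventually_elim)
        case (elim x)
        show ?case using bV(2)[OF R[OF elim] geD[OF d(2)]] elim K(2) by (auto simp: algebra_simps)
      qed
      finally have 3: "ennreal (t * (d + t * ln M) - \<Phi> \<mu>) \<le> nn_energy M \<mu> \<nu>" .
      have "ennreal (t * (c + t * ln M) - \<Phi> \<nu>) = (\<integral>\<^sup>+x. ennreal ((c + t * ln M) - \<phi> x) \<partial>\<nu>)"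
        using elim by (intro nn[symmetric] V Kae) auto
      also have "\<dots> \<le> nn_energy M \<nu> \<mu>"
        unfolding nn_energy_def
      proof (rule nn_integral_mono_AE, use Kae(2) in eventually_elim)
        case (elim x)
        show ?case using bM(2)[OF R[OF elim] geD[OF c(2)]] elim K(2) by (auto simp: algebra_simps)
      qed
      finally have 4: "ennreal (t * (c + t * ln M) - \<Phi> \<nu>) \<le> nn_energy M \<nu> \<mu>" .
      have \<Phi>_le: "\<Phi> \<rho> \<le> t * F" if "finite_borel_measure \<rho>" "emeasure \<rho> UNIV = ennreal t" "AE x in \<rho>. x \<in> ?K" for \<rho>
      proof -
        interpret finite_borel_measure \<rho> by fact
        have sp: "space \<rho> = UNIV" using sets_eq_imp_space_eq[OF M_is_borel] by simp
        have "AE x in \<rho>. indicator ?K x * \<phi> x \<le> F"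
          using that(3) by eventually_elim (use F in fastforce)
        then have "\<Phi> \<rho> \<le> (\<integral>x. F \<partial>\<rho>)"
          unfolding \<Phi>_def by (intro integral_mono_AE int that(1) integrable_const)
        then show ?thesis using sp that(2) t by (simp add: measure_def)
      qed
      have "0 \<le> t * err M" using e t by simp
      then have nonneg: "t * (d + t * ln M) - \<Phi> \<mu> \<ge> 0" "t * (c + t * ln M) - \<Phi> \<nu> \<ge> 0"
          "t * (c + t * ln M + err M) - \<Phi> \<mu> \<ge> 0" "t * (d + t * ln M + err M) - \<Phi> \<nu> \<ge> 0"
        using \<Phi>_le[OF M(1,2) Kae(1)] \<Phi>_le[OF V(1,2) Kae(2)] elim e t
          mult_left_mono[of F "d + t * ln M" t] mult_left_mono[of F "c + t * ln M" t]
        unfolding distrib_left by linarith+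
      have "D \<ge> 0" unfolding D_def using diff_energy_poisson_nonneg[OF M(1) V(1), of 2] by simp
      have "ennreal (t * (d + t * ln M) - \<Phi> \<mu>) + ennreal (t * (c + t * ln M) - \<Phi> \<nu>) + ennreal D
        \<le> nn_energy M \<mu> \<nu> + nn_energy M \<nu> \<mu> + ennreal D"
        by (intro add_mono 3 4 order_refl)
      also have "\<dots> \<le> nn_energy M \<mu> \<mu> + nn_energy M \<nu> \<nu>"
        unfolding D_def by (rule nn_energy_ge[OF M(1) V(1)]) (use elim in simp)
      also have "\<dots> \<le> ennreal (t * (c + t * ln M + err M) - \<Phi> \<mu>) + ennreal (t * (d + t * ln M + err M) - \<Phi> \<nu>)"
        by (intro add_mono 1 2)
      finally show ?case
        using nonneg \<open>D \<ge> 0\<close> by (simp add: algebra_simps flip: ennreal_plus)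
    qed
  qed
  moreover have "((\<lambda>M. 2 * t * err M) \<longlongrightarrow> 0) at_top"
    unfolding err_def by real_asymp
  ultimately have "D \<le> 0"
    by (intro tendsto_lowerbound[of _ 0 at_top]) auto
  then show ?thesis
    using eq_if_diff_energy_poisson_0[OF M(1) V(1) M(2) V(2) t] by (simp add: D_def)
qed

section \<open>Logarithmic integrals over the unit circle\<close>

definition poisson_kernel :: "real \<Rightarrow> real \<Rightarrow> real" where
  "poisson_kernel \<kappa> t = (1 - \<kappa>\<^sup>2) / (1 + \<kappa>\<^sup>2 - 2 * \<kappa> * cos t)"

lemma poisson_kernel_denom_pos:
  fixes \<kappa> t :: real
  assumes "\<bar>\<kappa>\<bar> < 1"
  shows "0 < 1 + \<kappa>\<^sup>2 - 2 * \<kappa> * cos t"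
proof -
  have "\<bar>\<kappa> * cos t\<bar> \<le> \<bar>\<kappa>\<bar> * 1" unfolding abs_mult by (rule mult_left_mono) auto
  then have "1 + \<kappa>\<^sup>2 - 2 * \<kappa> * cos t \<ge> 1 + \<bar>\<kappa>\<bar>\<^sup>2 - 2 * \<bar>\<kappa>\<bar>" by (simp add: abs_le_iff)
  moreover have "1 + \<bar>\<kappa>\<bar>\<^sup>2 - 2 * \<bar>\<kappa>\<bar> = (1 - \<bar>\<kappa>\<bar>)\<^sup>2" by (simp add: power2_eq_square algebra_simps)
  moreover have "(1 - \<bar>\<kappa>\<bar>)\<^sup>2 > 0" using assms by simp
  ultimately show ?thesis by linarith
qed

lemma poisson_kernel_continuous [continuous_intros]:
  "\<bar>\<kappa>\<bar> < 1 \<Longrightarrow> continuous_on A (poisson_kernel \<kappa>)"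
  unfolding poisson_kernel_def[abs_def]
  by (intro continuous_intros ballI) (use poisson_kernel_denom_pos in \<open>auto simp: less_le\<close>)

lemma circle_cauchy:
  fixes g :: "complex \<Rightarrow> complex"
  assumes "g holomorphic_on ball 0 R" "1 < R" "cmod z < 1"
  shows "((\<lambda>t. g (cis t) / (cis t - z) ^ Suc k * cis t) has_integral (of_real (2 * pi) / fact k * (deriv ^^ k) g z)) {0..2 * pi}"
proof -
  have sub: "cball 0 1 \<subseteq> ball (0::complex) R" using assms(2) by auto
  have "((\<lambda>u. g u / (u - z) ^ Suc k) has_contour_integral (of_real (2 * pi) * \<i> / fact k * (deriv ^^ k) g z)) (circlepath 0 1)"
    using assms sub
    by (intro Cauchy_has_contour_integral_higher_derivative_circlepath)
       (auto intro: holomorphic_on_subset holomorphic_on_imp_continuous_on)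
  then have "((\<lambda>t. g (cis t) / (cis t - z) ^ Suc k * \<i> * cis t) has_integral (of_real (2 * pi) * \<i> / fact k * (deriv ^^ k) g z)) {0..2 * pi}"
    unfolding circlepath_def by (subst (asm) has_contour_integral_part_circlepath_iff) auto
  then have "((\<lambda>t. - \<i> * (g (cis t) / (cis t - z) ^ Suc k * \<i> * cis t)) has_integral (- \<i> * (of_real (2 * pi) * \<i> / fact k * (deriv ^^ k) g z))) {0..2 * pi}"
    by (rule has_integral_mult_right)
  moreover have "- \<i> * (g (cis t) / (cis t - z) ^ Suc k * \<i> * cis t) = g (cis t) / (cis t - z) ^ Suc k * cis t" for t
    by (simp add: algebra_simps)
  moreover have "- \<i> * (of_real (2 * pi) * \<i> / fact k * (deriv ^^ k) g z) = of_real (2 * pi) / fact k * (deriv ^^ k) g z"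
    by (simp add: algebra_simps)
  ultimately show ?thesis by simp
qed

context
  fixes f :: "complex \<Rightarrow> complex" and R :: real
  assumes holo: "f holomorphic_on ball 0 R" and R: "1 < R"
begin

text \<open>On the circle the Poisson kernel is
  \<open>z / (z - \<kappa>) + \<kappa> * z / (1 - \<kappa> * z)\<close>. The first summand gives
  Cauchy's formula at \<open>\<kappa>\<close>. The second is holomorphic for
  \<open>\<bar>z\<bar> < 1 / \<bar>\<kappa>\<bar>\<close>, beyond the unit circle, and vanishes at
  0, so it contributes nothing.\<close>

lemma circle_poisson:
  fixes \<kappa> :: real
  assumes "\<bar>\<kappa>\<bar> < 1"
  shows "((\<lambda>t. f (cis t) * of_real (poisson_kernel \<kappa> t)) has_integral of_real (2 * pi) * f \<kappa>) {0..2 * pi}"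
proof (cases "\<kappa> = 0")
  case True
  then show ?thesis using circle_cauchy[OF holo R, of 0 0] by (simp add: poisson_kernel_def)
next
  case False
  define R' where "R' = min R (1 / \<bar>\<kappa>\<bar>)"
  define g where "g u = f u * (\<kappa> * u / (1 - \<kappa> * u))" for u :: complex
  have R': "1 < R'" using R assms False by (auto simp: R'_def)
  have ne: "1 - \<kappa> * u \<noteq> 0" if "cmod u < 1 / \<bar>\<kappa>\<bar>" for u :: complex
  proof
    assume "1 - \<kappa> * u = 0"
    then have "complex_of_real \<kappa> * u = 1" by simp
    then have "cmod (complex_of_real \<kappa> * u) = 1" by simp
    then have "\<bar>\<kappa>\<bar> * cmod u = 1" by (simp add: norm_mult)
    moreover have "\<bar>\<kappa>\<bar> * cmod u < 1" using that False by (simp add: pos_less_divide_eq mult.commute)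
    ultimately show False by simp
  qed
  then have "g holomorphic_on ball 0 R'"
    unfolding g_def by (intro holomorphic_intros holomorphic_on_subset[OF holo]) (auto simp: R'_def)
  from circle_cauchy[OF this R', of 0 0]
  have g: "((\<lambda>t. g (cis t)) has_integral 0) {0..2 * pi}" by (simp add: g_def mult.assoc)
  have f: "((\<lambda>t. f (cis t) / (cis t - \<kappa>) * cis t) has_integral of_real (2 * pi) * f \<kappa>) {0..2 * pi}"
    using circle_cauchy[OF holo R, of \<kappa> 0] assms by simp
  have eq: "g (cis t) + f (cis t) / (cis t - \<kappa>) * cis t = f (cis t) * of_real (poisson_kernel \<kappa> t)" for t
  proof -
    define z where "z = cis t"
    have z: "z \<noteq> 0" "cmod z = 1" by (auto simp: z_def)
    have cos: "complex_of_real (cos t) = (z + inverse z) / 2"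
      unfolding z_def by (simp add: complex_eq_iff cis_inverse)
    have "z - \<kappa> \<noteq> 0" using z assms by auto
    moreover have "1 - \<kappa> * z \<noteq> 0" using ne[of z] z assms False by simp
    ultimately have ne: "z - \<kappa> \<noteq> 0" "1 - \<kappa> * z \<noteq> 0" .
    have "complex_of_real (1 + \<kappa>\<^sup>2 - 2 * \<kappa> * cos t) = 1 + \<kappa>\<^sup>2 - \<kappa> * (z + inverse z)"
      by (simp add: cos)
    also have "\<dots> = (z - \<kappa>) * (1 - \<kappa> * z) / z"
      using z(1) by (simp add: field_simps power2_eq_square)
    finally have "complex_of_real (poisson_kernel \<kappa> t) = (1 - (complex_of_real \<kappa>)\<^sup>2) * z / ((z - \<kappa>) * (1 - \<kappa> * z))"
      unfolding poisson_kernel_def of_real_divide by simp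
    also have "\<dots> = (\<kappa> * z * (z - \<kappa>) + z * (1 - \<kappa> * z)) / ((1 - \<kappa> * z) * (z - \<kappa>))"
      by (simp add: algebra_simps power2_eq_square)
    also have "\<dots> = \<kappa> * z / (1 - \<kappa> * z) + z / (z - \<kappa>)"
      by (rule add_frac_eq[symmetric]) (use ne in auto)
    finally show ?thesis unfolding g_def z_def[symmetric] by (simp add: distrib_left)
  qed
  show ?thesis
    using has_integral_add[OF g f] unfolding eq by simp
qed

text \<open>In \<open>cos (k * t) = (z ^ k + 1 / z ^ k) / 2\<close> the negative power extracts a
  Taylor coefficient of \<open>f\<close> at 0 and the positive power integrates to 0.\<close>

lemma circle_cos:
  shows "((\<lambda>t. f (cis t) * of_real (cos t)) has_integral of_real pi * deriv f 0) {0..2 * pi}"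
    and "((\<lambda>t. f (cis t) * of_real (cos (2 * t))) has_integral of_real pi / 2 * deriv (deriv f) 0) {0..2 * pi}"
proof -
  note c = circle_cauchy[OF holo R, of 0]
  have z: "((\<lambda>t. f (cis t) * cis t ^ Suc k) has_integral 0) {0..2 * pi}" for k
  proof -
    have "(\<lambda>u. f u * u ^ Suc k) holomorphic_on ball 0 R" by (intro holomorphic_intros holo)
    from circle_cauchy[OF this R, of 0 0] show ?thesis by (simp add: mult_ac)
  qed
  have "(F / (z - 0) ^ Suc 1 * z + F * z ^ Suc 0) / 2 = F * ((z + inverse z) / 2)" if "z \<noteq> 0" for z F :: complex
    using that by (simp add: field_simps)
  moreover have "complex_of_real (cos t) = (cis t + inverse (cis t)) / 2" for t
    by (simp add: complex_eq_iff cis_inverse)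
  ultimately have 1: "(f (cis t) / (cis t - 0) ^ Suc 1 * cis t + f (cis t) * cis t ^ Suc 0) / 2 = f (cis t) * of_real (cos t)" for t
    by (metis cis_neq_zero)
  have "((\<lambda>t. (f (cis t) / (cis t - 0) ^ Suc 1 * cis t + f (cis t) * cis t ^ Suc 0) / 2) has_integral
      (of_real (2 * pi) / fact 1 * (deriv ^^ 1) f 0 + 0) / 2) {0..2 * pi}"
    by (intro has_integral_divide has_integral_add c z) auto
  then show "((\<lambda>t. f (cis t) * of_real (cos t)) has_integral of_real pi * deriv f 0) {0..2 * pi}"
    unfolding 1 by simp
  have "(F / (z - 0) ^ Suc 2 * z + F * z ^ Suc 1) / 2 = F * ((z\<^sup>2 + (inverse z)\<^sup>2) / 2)" if "z \<noteq> 0" for z F :: complex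
    using that by (simp add: field_simps power2_eq_square power3_eq_cube)
  moreover have "complex_of_real (cos (2 * t)) = ((cis t)\<^sup>2 + (inverse (cis t))\<^sup>2) / 2" for t
    unfolding cis_inverse Complex.DeMoivre by (simp add: complex_eq_iff)
  ultimately have 2: "(f (cis t) / (cis t - 0) ^ Suc 2 * cis t + f (cis t) * cis t ^ Suc 1) / 2 = f (cis t) * of_real (cos (2 * t))" for t
    by (metis cis_neq_zero)
  have "((\<lambda>t. (f (cis t) / (cis t - 0) ^ Suc 2 * cis t + f (cis t) * cis t ^ Suc 1) / 2) has_integral
      (of_real (2 * pi) / fact 2 * (deriv ^^ 2) f 0 + 0) / 2) {0..2 * pi}"
    by (intro has_integral_divide has_integral_add c z) auto
  then show "((\<lambda>t. f (cis t) * of_real (cos (2 * t))) has_integral of_real pi / 2 * deriv (deriv f) 0) {0..2 * pi}"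
    unfolding 2 by (simp add: eval_nat_numeral)
qed

end

section \<open>Logarithmic potentials of trigonometric weights\<close>

definition trig_weight :: "real \<Rightarrow> real \<Rightarrow> real \<Rightarrow> real \<Rightarrow> real \<Rightarrow> real \<Rightarrow> real" where
  "trig_weight q0 q1 q2 g \<kappa> t = q0 + q1 * cos t + q2 * cos (2 * t) + g * poisson_kernel \<kappa> t"

text \<open>The mean of \<open>ln (cmod (w - cis t))\<close> against \<open>trig_weight\<close>. The
  cosine terms see the first two Taylor coefficients in \<open>u\<close> of a logarithm of
  \<open>w - u\<close>, and the Poisson term sees its value at \<open>u = \<kappa>\<close>.\<close>

definition trig_potential :: "real \<Rightarrow> real \<Rightarrow> real \<Rightarrow> real \<Rightarrow> real \<Rightarrow> complex \<Rightarrow> real" where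
  "trig_potential q0 q1 q2 g \<kappa> w =
     q0 * ln (cmod w) - q1 / 2 * Re (1 / w) - q2 / 4 * Re (1 / w\<^sup>2) + g * ln (cmod (w - of_real \<kappa>))"

lemma trig_weight_continuous [continuous_intros]:
  "\<bar>\<kappa>\<bar> < 1 \<Longrightarrow> continuous_on A (trig_weight q0 q1 q2 g \<kappa>)"
  unfolding trig_weight_def[abs_def] by (intro continuous_intros) auto

lemma trig_potential_outside:
  fixes \<kappa> q0 q1 q2 g :: real
  assumes \<kappa>: "\<bar>\<kappa>\<bar> < 1" and w: "1 < cmod w"
  shows "((\<lambda>t. ln (cmod (w - cis t)) * trig_weight q0 q1 q2 g \<kappa> t)
    has_integral 2 * pi * trig_potential q0 q1 q2 g \<kappa> w) {0..2 * pi}"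
proof -
  \<comment> \<open>A holomorphic function with real part \<open>ln (cmod (w - u))\<close>.
    Factoring out \<open>w\<close> keeps the argument of \<open>Ln\<close> in the right half-plane,
    away from the branch cut.\<close>
  define f where "f u = of_real (ln (cmod w)) + Ln (1 - u / w)" for u
  have w0: "w \<noteq> 0" using w by auto
  have Re: "0 < Re (1 - u / w)" if "cmod u < cmod w" for u
  proof -
    have "Re (u / w) \<le> cmod (u / w)" by (rule complex_Re_le_cmod)
    also have "\<dots> < 1" using that w by (simp add: norm_divide divide_less_eq)
    finally show ?thesis by simp
  qed
  have nonpos: "1 - u / w \<notin> \<real>\<^sub>\<le>\<^sub>0" if "cmod u < cmod w" for u
    using Re[OF that] complex_nonpos_Reals_iff[of "1 - u / w"] by auto
  have holo: "f holomorphic_on ball 0 (cmod w)"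
    unfolding f_def using nonpos w0 by (intro holomorphic_intros) auto
  have Re_f: "Re (f u) = ln (cmod (w - u))" if "cmod u < cmod w" for u
  proof -
    have ne: "1 - u / w \<noteq> 0" using Re[OF that] by auto
    have "w - u = w * (1 - u / w)" using w0 by (simp add: field_simps)
    then have "ln (cmod (w - u)) = ln (cmod w) + ln (cmod (1 - u / w))"
      using ne w0 by (simp add: norm_mult ln_mult)
    then show ?thesis using ne by (simp add: f_def Re_Ln)
  qed
  have deriv_f: "deriv f u = - 1 / (w - u)" if "cmod u < cmod w" for u
  proof (rule DERIV_imp_deriv)
    have "w - u \<noteq> 0" using that by auto
    then show "(f has_field_derivative - 1 / (w - u)) (at u)"
      unfolding f_def using nonpos[OF that] w0
      by (auto intro!: derivative_eq_intros simp: divide_simps)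
  qed
  have d1: "deriv f 0 = - 1 / w" using deriv_f[of 0] w0 by simp
  have "deriv (deriv f) 0 = deriv (\<lambda>u. - 1 / (w - u)) 0"
  proof (rule deriv_cong_ev)
    have "\<forall>\<^sub>F u in nhds 0. u \<in> ball 0 (cmod w)"
      using w0 by (intro eventually_nhds_in_open) auto
    then show "\<forall>\<^sub>F u in nhds 0. deriv f u = - 1 / (w - u)"
      by eventually_elim (simp add: deriv_f)
  qed simp
  also have "\<dots> = - 1 / w\<^sup>2"
    by (rule DERIV_imp_deriv) (use w0 in \<open>auto intro!: derivative_eq_intros simp: power2_eq_square\<close>)
  finally have d2: "deriv (deriv f) 0 = - 1 / w\<^sup>2" .
  have cis: "Re (f (cis t)) = ln (cmod (w - cis t))" for t using Re_f[of "cis t"] w by simp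
  note P = has_integral_Re[OF circle_poisson[OF holo w \<kappa>]]
  note P0 = has_integral_Re[OF circle_poisson[OF holo w, of 0]]
  note C1 = has_integral_Re[OF circle_cos(1)[OF holo w]]
  note C2 = has_integral_Re[OF circle_cos(2)[OF holo w]]
  have "((\<lambda>t. q0 * ln (cmod (w - cis t)) + q1 * (ln (cmod (w - cis t)) * cos t)
      + q2 * (ln (cmod (w - cis t)) * cos (2 * t)) + g * (ln (cmod (w - cis t)) * poisson_kernel \<kappa> t))
    has_integral q0 * (2 * pi * ln (cmod w)) + q1 * (pi * Re (- 1 / w)) + q2 * (pi / 2 * Re (- 1 / w\<^sup>2))
      + g * (2 * pi * ln (cmod (w - \<kappa>)))) {0..2 * pi}"
  proof (intro has_integral_add has_integral_mult_right)
    have R: "Re (complex_of_real pi * z) = pi * Re z" for z by simp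
    show "((\<lambda>t. ln (cmod (w - cis t))) has_integral 2 * pi * ln (cmod w)) {0..2 * pi}"
      using P0 Re_f[of 0] w0 by (simp add: cis poisson_kernel_def)
    show "((\<lambda>t. ln (cmod (w - cis t)) * cos t) has_integral pi * Re (- 1 / w)) {0..2 * pi}"
      using C1[unfolded d1 R] by (simp add: cis)
    have R2: "Re (complex_of_real pi / 2 * z) = pi / 2 * Re z" for z
    proof -
      have "complex_of_real pi / 2 * z = (pi / 2) *\<^sub>R z" by (simp add: scaleR_conv_of_real)
      then show ?thesis by simp
    qed
    show "((\<lambda>t. ln (cmod (w - cis t)) * cos (2 * t)) has_integral pi / 2 * Re (- 1 / w\<^sup>2)) {0..2 * pi}"
      using C2[unfolded d2 R2] by (simp add: cis)
    show "((\<lambda>t. ln (cmod (w - cis t)) * poisson_kernel \<kappa> t) has_integral 2 * pi * ln (cmod (w - \<kappa>))) {0..2 * pi}"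
      using P Re_f[of \<kappa>] \<kappa> w by (simp add: cis)
  qed
  then show ?thesis
    by (rule has_integral_eq_rhs[OF has_integral_eq[rotated]])
       (simp_all add: trig_weight_def trig_potential_def algebra_simps)
qed

lemma trig_potential_integral_outside:
  fixes \<kappa> q0 q1 q2 g :: real
  assumes \<kappa>: "\<bar>\<kappa>\<bar> < 1" and w: "1 < cmod w"
  defines "G \<equiv> \<lambda>t. indicator {0..2 * pi} t * (trig_weight q0 q1 q2 g \<kappa> t * ln (cmod (w - cis t)))"
  shows "integrable lborel G" "integral\<^sup>L lborel G = 2 * pi * trig_potential q0 q1 q2 g \<kappa> w"
proof -
  have "w - cis t \<noteq> 0" for t using w by auto
  then have "continuous_on {0..2 * pi} (\<lambda>t. trig_weight q0 q1 q2 g \<kappa> t * ln (cmod (w - cis t)))"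
    using \<kappa> by (intro continuous_intros) auto
  then have int: "set_integrable lborel {0..2 * pi} (\<lambda>t. trig_weight q0 q1 q2 g \<kappa> t * ln (cmod (w - cis t)))"
    by (rule borel_integrable_atLeastAtMost')
  then show "integrable lborel G" by (simp add: set_integrable_def G_def)
  show "integral\<^sup>L lborel G = 2 * pi * trig_potential q0 q1 q2 g \<kappa> w"
    using set_borel_integral_eq_integral(2)[OF int]
      integral_unique[OF trig_potential_outside[OF \<kappa> w, of q0 q1 q2 g]]
    by (simp add: set_lebesgue_integral_def G_def mult.commute)
qed

text \<open>On the circle itself, \<open>\<bar>\<rho> w - z\<bar>\<close> decreases to \<open>\<bar>w - z\<bar>\<close> as \<open>\<rho>\<close> decreases to 1.\<close>

lemma cmod_scaled_diff_mono:
  fixes \<rho> \<rho>' :: real and w z :: complex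
  assumes "cmod w = 1" "cmod z = 1" "1 \<le> \<rho>" "\<rho> \<le> \<rho>'"
  shows "cmod (\<rho> * w - z) \<le> cmod (\<rho>' * w - z)"
proof -
  have *: "(cmod (r * w - z))\<^sup>2 = 1 + r\<^sup>2 - 2 * r * Re (w * cnj z)" for r :: real
  proof -
    have "(cmod (r * w - z))\<^sup>2 = (r * Re w - Re z)\<^sup>2 + (r * Im w - Im z)\<^sup>2" by (simp add: cmod_power2)
    also have "\<dots> = r\<^sup>2 * ((Re w)\<^sup>2 + (Im w)\<^sup>2) + ((Re z)\<^sup>2 + (Im z)\<^sup>2) - 2 * r * Re (w * cnj z)"
      by (simp add: power2_eq_square algebra_simps)
    finally show ?thesis using assms(1,2) by (simp flip: cmod_power2)
  qed
  have c: "Re (w * cnj z) \<le> 1"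
    using complex_Re_le_cmod[of "w * cnj z"] assms by (simp add: norm_mult)
  have "2 * (\<rho>' - \<rho>) * Re (w * cnj z) \<le> 2 * (\<rho>' - \<rho>) * 1" using c assms by (intro mult_left_mono) auto
  also have "\<dots> \<le> (\<rho>' + \<rho>) * (\<rho>' - \<rho>)"
    using assms mult_right_mono[of 2 "\<rho>' + \<rho>" "\<rho>' - \<rho>"] by simp
  finally have "(cmod (\<rho> * w - z))\<^sup>2 \<le> (cmod (\<rho>' * w - z))\<^sup>2"
    unfolding * by (simp add: power2_eq_square algebra_simps)
  then show ?thesis by (simp add: power2_le_iff_abs_le)
qed

lemma AE_cis_neq: "AE t in lborel. cis t \<noteq> w"
proof (cases "cmod w = 1")
  case True
  have "{t. cis t = w} \<subseteq> range (\<lambda>n::int. Arg w + 2 * pi * of_int n)"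
  proof
    fix t assume "t \<in> {t. cis t = w}"
    moreover have "w \<noteq> 0" using True by auto
    ultimately have "cis t = cis (Arg w)" using True by (simp add: cis_Arg sgn_eq)
    then show "t \<in> range (\<lambda>n::int. Arg w + 2 * pi * of_int n)"
      using sin_cos_eq_iff[of t "Arg w"] by (auto simp: complex_eq_iff)
  qed
  then have "countable {t. cis t = w}" by (rule countable_subset) simp
  then have "AE t in lborel. t \<notin> {t. cis t = w}"
    by (intro AE_not_in countable_imp_null_set_lborel)
  then show ?thesis by simp
qed auto

text \<open>On the circle the integrand may be unbounded, and its integrability is itself a result
  of monotone convergence along \<open>\<rho> n * w\<close>. Nonnegativity of the weight turns
  monotonicity of the logarithms into monotonicity of the integrands.\<close>

lemma trig_potential_integral:
  fixes \<kappa> q0 q1 q2 g :: real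
  assumes \<kappa>: "\<bar>\<kappa>\<bar> < 1" and w: "1 \<le> cmod w"
    and nonneg: "\<And>t. trig_weight q0 q1 q2 g \<kappa> t \<ge> 0"
  defines "G \<equiv> \<lambda>w t. indicator {0..2 * pi} t * (trig_weight q0 q1 q2 g \<kappa> t * ln (cmod (w - cis t)))"
  shows "integrable lborel (G w)" "integral\<^sup>L lborel (G w) = 2 * pi * trig_potential q0 q1 q2 g \<kappa> w"
proof -
  have "integrable lborel (G w) \<and> integral\<^sup>L lborel (G w) = 2 * pi * trig_potential q0 q1 q2 g \<kappa> w"
  proof (cases "cmod w = 1")
    case False
    then have "1 < cmod w" using w by simp
    from trig_potential_integral_outside[OF \<kappa> this, of q0 q1 q2 g] show ?thesis by (simp add: G_def)
  next
    case True
    define \<rho> where "\<rho> n = 1 + 1 / real (Suc n)" for n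
    have \<rho>: "1 < \<rho> n" for n by (simp add: \<rho>_def)
    have \<rho>_lim: "\<rho> \<longlonglongrightarrow> 1"
      unfolding \<rho>_def using tendsto_add[OF tendsto_const LIMSEQ_Suc[OF lim_1_over_n]] by simp
    have cm: "1 < cmod (\<rho> n * w)" for n using True \<rho>[of n] by (simp add: norm_mult)
    have out: "integrable lborel (G (\<rho> n * w))"
        "integral\<^sup>L lborel (G (\<rho> n * w)) = 2 * pi * trig_potential q0 q1 q2 g \<kappa> (\<rho> n * w)" for n
      using trig_potential_integral_outside[OF \<kappa> cm, of q0 q1 q2 g] by (simp_all add: G_def)
    have cmeas [measurable]: "trig_weight q0 q1 q2 g \<kappa> \<in> borel_measurable borel"
      by (intro borel_measurable_continuous_onI continuous_intros \<kappa>)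
    have [measurable]: "cis \<in> borel_measurable borel"
      by (intro borel_measurable_continuous_onI continuous_intros)
    have meas: "G w \<in> borel_measurable lborel" unfolding G_def by measurable
    have ne: "w \<noteq> of_real \<kappa>" "w \<noteq> 0" using True \<kappa> by auto
    have lim: "AE t in lborel. (\<lambda>n. G (\<rho> n * w) t) \<longlonglongrightarrow> G w t"
      using AE_cis_neq[of w]
    proof eventually_elim
      case (elim t)
      have "(\<lambda>n. G (\<rho> n * w) t) \<longlonglongrightarrow> G (of_real 1 * w) t"
        unfolding G_def using elim by (intro tendsto_intros \<rho>_lim) auto
      then show ?case by simp
    qed
    have mono: "decseq (\<lambda>n. G (\<rho> n * w) t)" for t
    proof (rule decseq_SucI)
      fix n
      have "cmod (\<rho> (Suc n) * w - cis t) \<le> cmod (\<rho> n * w - cis t)"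
        by (rule cmod_scaled_diff_mono) (use True in \<open>auto simp: \<rho>_def frac_le\<close>)
      moreover have "0 < cmod (\<rho> (Suc n) * w - cis t)" using cm[of "Suc n"] by auto
      ultimately have "ln (cmod (\<rho> (Suc n) * w - cis t)) \<le> ln (cmod (\<rho> n * w - cis t))"
        by (subst ln_le_cancel_iff) linarith+
      then show "G (\<rho> (Suc n) * w) t \<le> G (\<rho> n * w) t"
        unfolding G_def by (intro mult_left_mono nonneg) auto
    qed
    have "(\<lambda>n. 2 * pi * trig_potential q0 q1 q2 g \<kappa> (\<rho> n * w)) \<longlonglongrightarrow> 2 * pi * trig_potential q0 q1 q2 g \<kappa> (of_real 1 * w)"
      unfolding trig_potential_def using ne by (intro tendsto_intros \<rho>_lim) auto
    then have L: "(\<lambda>n. - integral\<^sup>L lborel (G (\<rho> n * w))) \<longlonglongrightarrow> - (2 * pi * trig_potential q0 q1 q2 g \<kappa> w)"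
      by (intro tendsto_minus) (simp add: out)
    have "has_bochner_integral lborel (\<lambda>t. - G w t) (- (2 * pi * trig_potential q0 q1 q2 g \<kappa> w))"
      using L
      by (intro has_bochner_integral_monotone_convergence[where f = "\<lambda>n t. - G (\<rho> n * w) t"])
         (use lim mono meas out(1) in \<open>auto simp: mono_iff_le_Suc decseq_Suc_iff elim!: eventually_mono intro!: tendsto_minus\<close>)
    then have "has_bochner_integral lborel (G w) (2 * pi * trig_potential q0 q1 q2 g \<kappa> w)"
      using has_bochner_integral_minus by fastforce
    then show ?thesis by (simp add: has_bochner_integral_iff)
  qed
  then show "integrable lborel (G w)" "integral\<^sup>L lborel (G w) = 2 * pi * trig_potential q0 q1 q2 g \<kappa> w"
    by auto
qed

section \<open>The measure with square root density\<close>

lemma trig_weight_integral: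
  fixes \<kappa> q0 q1 q2 g :: real
  assumes "\<bar>\<kappa>\<bar> < 1"
  shows "(trig_weight q0 q1 q2 g \<kappa> has_integral 2 * pi * (q0 + g)) {0..2 * pi}"
proof -
  have one: "(\<lambda>_. 1) holomorphic_on ball (0::complex) 2" by (intro holomorphic_intros)
  note P = has_integral_Re[OF circle_poisson[OF one _ assms]]
  note C = circle_cos[OF one, THEN has_integral_Re]
  have "((\<lambda>t. q0 + q1 * cos t + q2 * cos (2 * t) + g * poisson_kernel \<kappa> t) has_integral
      q0 * (2 * pi) + q1 * 0 + q2 * 0 + g * (2 * pi)) {0..2 * pi}"
    using P C has_integral_const_real[of q0 0 "2 * pi"]
    by (intro has_integral_add has_integral_mult_right) (auto simp: mult.commute)
  then show ?thesis
    by (simp add: trig_weight_def[abs_def] algebra_simps)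
qed

text \<open>The map from the circle to the segment is two-to-one. Folding reduces integrals to
  \<open>{0..pi}\<close>, where it is injective and substitution applies.\<close>

lemma nn_integral_fold_circle:
  fixes f :: "real \<Rightarrow> ennreal"
  assumes [measurable]: "f \<in> borel_measurable borel" and sym: "\<And>t. f (2 * pi - t) = f t"
  shows "(\<integral>\<^sup>+t. f t * indicator {0..2 * pi} t \<partial>lborel) = 2 * (\<integral>\<^sup>+t. f t * indicator {0..pi} t \<partial>lborel)"
proof -
  have "(\<integral>\<^sup>+t. f t * indicator {0..2 * pi} t \<partial>lborel)
      = (\<integral>\<^sup>+t. f t * indicator {0..pi} t + f t * indicator {pi<..2 * pi} t \<partial>lborel)"
    by (rule nn_integral_cong) (auto split: split_indicator)
  also have "\<dots> = (\<integral>\<^sup>+t. f t * indicator {0..pi} t \<partial>lborel) + (\<integral>\<^sup>+t. f t * indicator {pi<..2 * pi} t \<partial>lborel)"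
    by (rule nn_integral_add) measurable
  also have "(\<integral>\<^sup>+t. f t * indicator {pi<..2 * pi} t \<partial>lborel)
      = (\<integral>\<^sup>+t. f (2 * pi + (-1) * t) * indicator {pi<..2 * pi} (2 * pi + (-1) * t) \<partial>lborel)"
  proof -
    have "(\<lambda>t. f t * indicator {pi<..2 * pi} t) \<in> borel_measurable borel" by measurable
    from nn_integral_real_affine[OF this, of "-1" "2 * pi"] show ?thesis by simp
  qed
  also have "\<dots> = (\<integral>\<^sup>+t. f t * indicator {0..pi} t \<partial>lborel)"
  proof (rule nn_integral_cong_AE)
    have "AE t in lborel. t \<noteq> pi" by (rule AE_lborel_singleton)
    then show "AE t in lborel. f (2 * pi + (-1) * t) * indicator {pi<..2 * pi} (2 * pi + (-1) * t) = f t * indicator {0..pi} t"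
    proof eventually_elim
      case (elim t)
      then have "indicator {pi<..2 * pi} (2 * pi + (-1) * t) = (indicator {0..pi} t :: ennreal)"
        by (auto split: split_indicator)
      then show ?case using sym[of t] by simp
    qed
  qed
  finally show ?thesis by (simp only: mult_2)
qed

lemma log_potential_eq_integral:
  assumes sets: "sets \<nu> = sets borel" and int: "integrable \<nu> (\<lambda>s. ln \<bar>x - s\<bar>)" and ne: "AE s in \<nu>. s \<noteq> x"
  shows "log_potential \<nu> x = ereal (- (\<integral>s. ln \<bar>x - s\<bar> \<partial>\<nu>))"
proof -
  have 1: "(\<integral>\<^sup>+s. e2ennreal (log_kernel x s) \<partial>\<nu>) = (\<integral>\<^sup>+s. ennreal (- ln \<bar>x - s\<bar>) \<partial>\<nu>)"
    by (rule nn_integral_cong_AE) (use ne in \<open>eventually_elim, auto simp: log_kernel_def\<close>)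
  have 2: "(\<integral>\<^sup>+s. e2ennreal (- log_kernel x s) \<partial>\<nu>) = (\<integral>\<^sup>+s. ennreal (ln \<bar>x - s\<bar>) \<partial>\<nu>)"
    by (rule nn_integral_cong_AE) (use ne in \<open>eventually_elim, auto simp: log_kernel_def\<close>)
  obtain p n where pn: "(\<integral>\<^sup>+s. ennreal (ln \<bar>x - s\<bar>) \<partial>\<nu>) = ennreal p" "p \<ge> 0"
      "(\<integral>\<^sup>+s. ennreal (- ln \<bar>x - s\<bar>) \<partial>\<nu>) = ennreal n" "n \<ge> 0"
      "(\<integral>s. ln \<bar>x - s\<bar> \<partial>\<nu>) = p - n"
    by (rule integrableE[OF int])
  show ?thesis
    unfolding log_potential_def 1 2 using pn by simp
qed

text \<open>
  Here \<open>B1 = b1 + 1\<close> and \<open>B2 = b2 + 1\<close>. The Stieltjes transform of the measure is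
  \<open>x + \<beta> + \<gamma> / (x + 1)\<close> minus \<open>(x - b1) (x - b2) / (x + 1) * sqrt ((x - a) / x)\<close>; the conditions on \<open>B1\<close> and \<open>B2\<close>
  say that it vanishes at infinity and has no pole at \<open>-1\<close>.
\<close>

locale sqrt_density =
  fixes a \<beta> \<gamma> B1 B2 :: real
  assumes a: "a > 0"
    and sum: "B1 + B2 = 1 - \<beta> - a / 2"
    and prod: "B1 * B2 = \<gamma> / sqrt (1 + a)"
    and B: "B1 < 1" "B2 < 1"
begin

definition \<kappa> :: real where "\<kappa> = (sqrt (1 + a) - 1) / (sqrt (1 + a) + 1)"
text \<open>\<open>Q0\<close>, \<open>Q1\<close> and \<open>Q2\<close> are the cosine coefficients
  of \<open>pi * dens x * sqrt (x * (a - x))\<close> at \<open>x = point \<theta>\<close> after its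
  Poisson term is split off. Each Poisson kernel has mean 1, so \<open>Q0 + \<gamma>\<close> is the
  total mass.\<close>

definition Q0 :: real where "Q0 = 3 * a\<^sup>2 / 8 + a * \<beta> / 2 - \<gamma> / sqrt (1 + a)"
definition Q1 :: real where "Q1 = a / 2 * (a / 2 + \<beta>)"
definition Q2 :: real where "Q2 = - a\<^sup>2 / 8"

definition point :: "real \<Rightarrow> real" where "point \<theta> = a / 2 * (1 - cos \<theta>)"

abbreviation weight :: "real \<Rightarrow> real" where "weight \<equiv> trig_weight Q0 Q1 Q2 \<gamma> \<kappa>"

definition dens :: "real \<Rightarrow> real" where
  "dens x = 1 / pi * ((x - (B1 - 1)) * (x - (B2 - 1)) / (x + 1)) * sqrt ((a - x) / x)"

definition meas :: "real measure" where
  "meas = density lborel (\<lambda>x. ennreal (indicator {0<..<a} x * dens x))"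

section \<open>Change of variables between the circle and the segment\<close>

lemma \<kappa>: "0 < \<kappa>" "\<kappa> < 1" "\<bar>\<kappa>\<bar> < 1"
proof -
  define r where "r = sqrt (1 + a)"
  have "r > 1" using a by (simp add: r_def)
  then show "0 < \<kappa>" "\<kappa> < 1" by (auto simp: \<kappa>_def r_def[symmetric])
  then show "\<bar>\<kappa>\<bar> < 1" by simp
qed

lemma a_eq: "a = 4 * \<kappa> / (1 - \<kappa>)\<^sup>2"
proof -
  define r where "r = sqrt (1 + a)"
  have r: "r > 1" "r\<^sup>2 = 1 + a" using a by (auto simp: r_def)
  have k: "\<kappa> = (r - 1) / (r + 1)" by (simp add: \<kappa>_def r_def)
  then have "1 - \<kappa> = 2 / (r + 1)" using r(1) by (simp add: field_simps)
  then have "4 * \<kappa> / (1 - \<kappa>)\<^sup>2 = (r - 1) * (r + 1)"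
    unfolding k using r(1) by (simp add: power2_eq_square)
  then show ?thesis using r(2) by (simp add: power2_eq_square algebra_simps)
qed

lemma point_bounds: "0 \<le> point \<theta>" "point \<theta> \<le> a"
  using a cos_ge_minus_one[of \<theta>] mult_left_mono[of "1 - cos \<theta>" 2 "a / 2"] by (auto simp: point_def)

lemma point_inside: "0 < \<theta> \<Longrightarrow> \<theta> < pi \<Longrightarrow> point \<theta> \<in> {0<..<a}"
  using a cos_monotone_0_pi[of 0 \<theta>] cos_monotone_0_pi[of \<theta> pi] by (auto simp: point_def)

text \<open>Since \<open>\<kappa>\<close> lies over \<open>x = -1\<close>, the distance of
  \<open>point \<theta>\<close> from the pole is proportional to
  \<open>(cmod (cis \<theta> - \<kappa>))\<^sup>2\<close>, the denominator of the Poisson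
  kernel.\<close>

lemma poisson_kernel_point: "poisson_kernel \<kappa> \<theta> = sqrt (1 + a) / (1 + point \<theta>)"
proof -
  define r where "r = sqrt (1 + a)"
  have r: "r > 1" "r\<^sup>2 = 1 + a" using a by (auto simp: r_def)
  have k: "\<kappa> = (r - 1) / (r + 1)" by (simp add: \<kappa>_def r_def)
  have pt: "point \<theta> = (r\<^sup>2 - 1) / 2 * (1 - cos \<theta>)" using r(2) by (simp add: point_def)
  have "1 - \<kappa>\<^sup>2 = 4 * r / (r + 1)\<^sup>2" using r(1) unfolding k by (simp add: divide_simps) (simp add: power2_eq_square algebra_simps)
  moreover have "1 + \<kappa>\<^sup>2 - 2 * \<kappa> * cos \<theta> = 4 * (1 + point \<theta>) / (r + 1)\<^sup>2"
    using r(1) unfolding k pt by (simp add: divide_simps) (simp add: power2_eq_square algebra_simps)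
  ultimately show ?thesis
    using r point_bounds[of \<theta>]
    by (simp add: poisson_kernel_def r_def[symmetric] del: distrib_left_numeral)
qed

text \<open>Expand in powers of \<open>x + 1\<close>: the condition \<open>sum\<close> fixes the
  polynomial part, and \<open>prod\<close> makes the coefficient of the Poisson kernel exactly
  \<open>\<gamma>\<close>, the strength of the logarithm in the field.\<close>

lemma weight_point:
  "weight \<theta> = (point \<theta> - (B1 - 1)) * (point \<theta> - (B2 - 1)) / (point \<theta> + 1) * (a - point \<theta>)"
proof -
  define x where "x = point \<theta>"
  have x: "x + 1 \<noteq> 0" using point_bounds[of \<theta>] by (simp add: x_def)
  define r where "r = sqrt (1 + a)"
  have r: "r \<noteq> 0" "r\<^sup>2 = 1 + a" using a by (auto simp: r_def)
  have "(x - (B1 - 1)) * (x - (B2 - 1)) = (x + 1)\<^sup>2 - (B1 + B2) * (x + 1) + B1 * B2"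
    by (simp add: power2_eq_square algebra_simps)
  then have "(x - (B1 - 1)) * (x - (B2 - 1)) / (x + 1) = x + 1 - (B1 + B2) + B1 * B2 / (x + 1)"
    using x by (simp add: add_divide_distrib diff_divide_distrib power2_eq_square)
  then have "(x - (B1 - 1)) * (x - (B2 - 1)) / (x + 1) * (a - x)
      = (x + \<beta> + a / 2) * (a - x) + (\<gamma> / r) * ((a - x) / (x + 1))"
    by (simp add: sum prod r_def distrib_right)
  also have "(a - x) / (x + 1) = r\<^sup>2 / (x + 1) - 1" using x r by (simp add: field_simps)
  also have "(x + \<beta> + a / 2) * (a - x) + (\<gamma> / r) * (r\<^sup>2 / (x + 1) - 1)
      = (x + \<beta> + a / 2) * (a - x) - \<gamma> / r + \<gamma> * (r / (1 + x))"
    using r(1) by (simp add: right_diff_distrib power2_eq_square add.commute)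
  also have "(x + \<beta> + a / 2) * (a - x) = 3 * a\<^sup>2 / 8 + a * \<beta> / 2 + Q1 * cos \<theta> + Q2 * cos (2 * \<theta>)"
  proof -
    have "(a / 2 * (1 - c) + \<beta> + a / 2) * (a - a / 2 * (1 - c))
        = 3 * a\<^sup>2 / 8 + a * \<beta> / 2 + a / 2 * (a / 2 + \<beta>) * c + (- a\<^sup>2 / 8) * (2 * c\<^sup>2 - 1)" for c
      by (simp add: field_simps power2_eq_square)
    then show ?thesis by (simp only: x_def point_def Q1_def Q2_def cos_double_cos)
  qed
  also have "3 * a\<^sup>2 / 8 + a * \<beta> / 2 + Q1 * cos \<theta> + Q2 * cos (2 * \<theta>) - \<gamma> / r + \<gamma> * (r / (1 + x)) = weight \<theta>"
    unfolding trig_weight_def poisson_kernel_point x_def[symmetric] r_def[symmetric] Q0_def by linarith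
  finally show ?thesis by (simp add: x_def)
qed

lemma weight_nonneg: "0 \<le> weight \<theta>"
  unfolding weight_point using point_bounds[of \<theta>] B by (intro mult_nonneg_nonneg divide_nonneg_nonneg) auto

text \<open>The Jacobian \<open>a / 2 * sin \<theta>\<close> equals
  \<open>sqrt (x * (a - x))\<close> at \<open>x = point \<theta>\<close> and cancels the inverse
  square root singularity at 0.\<close>

lemma dens_point:
  assumes "0 < \<theta>" "\<theta> < pi"
  shows "dens (point \<theta>) * (a / 2 * sin \<theta>) = weight \<theta> / pi"
proof -
  have s: "sin \<theta> > 0" using assms by (rule sin_gt_zero)
  have c: "cos \<theta> < 1" "- 1 < cos \<theta>"
    using cos_monotone_0_pi[of 0 \<theta>] cos_monotone_0_pi[of \<theta> pi] assms by auto
  have "(a - point \<theta>) / point \<theta> = (1 + cos \<theta>) / (1 - cos \<theta>)"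
    using a c by (simp add: point_def divide_simps) (simp add: algebra_simps)
  also have "\<dots> = ((1 + cos \<theta>) / sin \<theta>)\<^sup>2"
  proof -
    have "(sin \<theta>)\<^sup>2 = (1 + cos \<theta>) * (1 - cos \<theta>)" by (simp add: sin_squared_eq algebra_simps power2_eq_square)
    then show ?thesis using c by (simp add: power_divide) (simp add: power2_eq_square)
  qed
  finally have "sqrt ((a - point \<theta>) / point \<theta>) * (a / 2 * sin \<theta>) = a - point \<theta>"
    using s c by (simp add: point_def) (simp add: algebra_simps)
  then show ?thesis unfolding dens_def weight_point mult.assoc by (simp only: mult_1_left times_divide_eq_left times_divide_eq_right divide_divide_eq_left mult.commute[of pi])
qed

lemma weight_measurable [measurable]: "weight \<in> borel_measurable borel"
  by (intro borel_measurable_continuous_onI continuous_intros \<kappa>)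

lemma point_measurable [measurable]: "point \<in> borel_measurable borel"
  unfolding point_def[abs_def] by measurable

lemma dens_measurable [measurable]: "dens \<in> borel_measurable borel"
  unfolding dens_def[abs_def] by measurable

lemma weight_sym: "weight (2 * pi - \<theta>) = weight \<theta>"
proof -
  have "cos (2 * (2 * pi - \<theta>)) = cos (2 * \<theta>)" by (simp only: cos_double_cos cos_2pi_minus)
  then show ?thesis by (simp only: trig_weight_def poisson_kernel_def cos_2pi_minus)
qed

lemma meas_eq_distr:
  "meas = distr (density lborel (\<lambda>\<theta>. ennreal (indicator {0..2 * pi} \<theta> * (weight \<theta> / (2 * pi))))) borel point"
  (is "_ = distr ?D borel point")
proof (rule measure_eqI)
  fix A assume "A \<in> sets meas"
  then have A [measurable]: "A \<in> sets borel" by (simp add: meas_def)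
  define F where "F x = indicator {0<..<a} x * dens x * indicator A x" for x
  have [measurable]: "F \<in> borel_measurable borel" unfolding F_def by measurable
  have p: "point 0 = 0" "point pi = a" by (auto simp: point_def)
  have "emeasure meas A = (\<integral>\<^sup>+x. ennreal (F x * indicator {point 0..point pi} x) \<partial>lborel)"
    unfolding meas_def by (subst emeasure_density) (auto simp: F_def p intro!: nn_integral_cong split: split_indicator)
  also have "\<dots> = (\<integral>\<^sup>+\<theta>. ennreal (F (point \<theta>) * (a / 2 * sin \<theta>) * indicator {0..pi} \<theta>) \<partial>lborel)"
    using a by (intro nn_integral_substitution)
      (auto simp: point_def[abs_def] set_borel_measurable_def intro!: derivative_eq_intros continuous_intros mult_nonneg_nonneg sin_ge_zero)
  \<comment> \<open>The half circle carries \<open>weight \<theta> / pi\<close>; the factor 2 is set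
    aside to unfold it to \<open>weight \<theta> / (2 * pi)\<close> on the whole circle.\<close>
  also have "\<dots> = (\<integral>\<^sup>+\<theta>. 2 * (ennreal (weight \<theta> / (2 * pi)) * indicator A (point \<theta>) * indicator {0..pi} \<theta>) \<partial>lborel)"
  proof (rule nn_integral_cong_AE)
    have "AE \<theta> in lborel. \<theta> \<noteq> 0" "AE \<theta> in lborel. \<theta> \<noteq> pi" by (rule AE_lborel_singleton)+
    then show "AE \<theta> in lborel. ennreal (F (point \<theta>) * (a / 2 * sin \<theta>) * indicator {0..pi} \<theta>)
        = 2 * (ennreal (weight \<theta> / (2 * pi)) * indicator A (point \<theta>) * indicator {0..pi} \<theta>)"
    proof eventually_elim
      case (elim \<theta>)
      show ?case
      proof (cases "\<theta> \<in> {0<..<pi}")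
        case True
        then have \<theta>: "0 < \<theta>" "\<theta> < pi" by auto
        have "2 * ennreal (weight \<theta> / (2 * pi)) = ennreal (2 * (weight \<theta> / (2 * pi)))"
          by (subst ennreal_mult) (auto simp: weight_nonneg)
        then show ?thesis using \<theta> point_inside[OF \<theta>] dens_point[OF \<theta>]
          by (auto simp: F_def mult.assoc split: split_indicator)
      qed (use elim in \<open>auto split: split_indicator\<close>)
    qed
  qed
  also have "\<dots> = 2 * (\<integral>\<^sup>+\<theta>. ennreal (weight \<theta> / (2 * pi)) * indicator A (point \<theta>) * indicator {0..pi} \<theta> \<partial>lborel)"
    by (rule nn_integral_cmult) measurable
  also have "\<dots> = (\<integral>\<^sup>+\<theta>. ennreal (weight \<theta> / (2 * pi)) * indicator A (point \<theta>) * indicator {0..2 * pi} \<theta> \<partial>lborel)"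
    by (rule nn_integral_fold_circle[symmetric])
       (simp_all add: weight_sym point_def)
  also have "\<dots> = emeasure (distr ?D borel point) A"
    using measurable_sets_borel[OF point_measurable A]
    by (subst emeasure_distr, simp, simp, subst emeasure_density)
       (auto intro!: nn_integral_cong split: split_indicator)
  finally show "emeasure meas A = emeasure (distr ?D borel point) A" .
qed (simp add: meas_def)

lemma meas_mass: "emeasure meas UNIV = ennreal (Q0 + \<gamma>)"
proof -
  have "(\<integral>\<^sup>+\<theta>. ennreal (indicator {0..2 * pi} \<theta> * (weight \<theta> / (2 * pi))) \<partial>lborel) = ennreal (Q0 + \<gamma>)"
  proof -
    have "((\<lambda>\<theta>. weight \<theta> / (2 * pi)) has_integral 2 * pi * (Q0 + \<gamma>) / (2 * pi)) {0..2 * pi}"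
      by (intro has_integral_divide trig_weight_integral \<kappa>)
    then have "(\<integral>\<^sup>+\<theta>. ennreal (weight \<theta> / (2 * pi)) * indicator {0..2 * pi} \<theta> \<partial>lborel) = ennreal (2 * pi * (Q0 + \<gamma>) / (2 * pi))"
      by (intro nn_integral_has_integral_lebesgue') (auto simp: weight_nonneg)
    then show ?thesis by (simp add: mult.commute indicator_mult_ennreal)
  qed
  then show ?thesis
    unfolding meas_eq_distr by (simp add: emeasure_distr emeasure_density)
qed

end

section \<open>The potential on the segment and to the right of it\<close>

context sqrt_density
begin

lemma point_complex: "complex_of_real (point \<theta>) = - (a / 4) * (cis \<theta> - 1)\<^sup>2 / cis \<theta>"
proof -
  have "complex_of_real (cos \<theta>) = (cis \<theta> + inverse (cis \<theta>)) / 2"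
    by (simp add: complex_eq_iff cis_inverse)
  moreover have "of_real a / 2 * (1 - (z + inverse z) / 2) = - (of_real a / 4) * (z - 1)\<^sup>2 / z"
    if "z \<noteq> 0" for z :: complex
    using that by (simp add: field_simps power2_eq_square)
  moreover have "complex_of_real (point \<theta>) = of_real a / 2 * (1 - of_real (cos \<theta>))"
    by (simp add: point_def)
  ultimately show ?thesis by (simp only: cis_neq_zero not_False_eq_True of_real_minus of_real_divide of_real_numeral)
qed

text \<open>The map identifies \<open>z\<close> with \<open>1 / z\<close>, so a difference of two of
  its values factors into \<open>w - z\<close> and \<open>w - 1 / z\<close>. For \<open>z\<close> on
  the circle \<open>1 / z\<close> is the conjugate of \<open>z\<close>. A logarithmic potential on
  the segment thus becomes a sum of two circle potentials, at \<open>w\<close> and at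
  \<open>cnj w\<close>, plus constants.\<close>

lemma dist_point:
  fixes w :: complex
  assumes "w \<noteq> 0" and x: "complex_of_real x = - (a / 4) * (w - 1)\<^sup>2 / w"
  shows "\<bar>x - point \<theta>\<bar> = a / 4 * cmod (w - cis \<theta>) * cmod (cnj w - cis \<theta>) / cmod w"
proof -
  have *: "- (of_real a / 4) * (w - 1)\<^sup>2 / w - - (of_real a / 4) * (z - 1)\<^sup>2 / z
      = - (of_real a / 4) * ((w - z) * (w - inverse z) / w)" if "z \<noteq> 0" for z :: complex
    using that assms(1) by (simp add: field_simps power2_eq_square)
  have "complex_of_real (x - point \<theta>) = - (of_real a / 4) * ((w - cis \<theta>) * (w - inverse (cis \<theta>)) / w)"
    using *[of "cis \<theta>"] by (simp add: x point_complex)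
  then have "cmod (complex_of_real (x - point \<theta>)) = a / 4 * (cmod (w - cis \<theta>) * cmod (w - inverse (cis \<theta>)) / cmod w)"
    using a by (simp add: norm_mult norm_divide)
  moreover have "cmod (w - inverse (cis \<theta>)) = cmod (cnj w - cis \<theta>)"
    by (metis cis_inverse cis_cnj complex_cnj_cnj complex_cnj_diff complex_mod_cnj)
  ultimately show ?thesis by (simp del: of_real_diff)
qed

lemma trig_potential_cnj: "trig_potential q0 q1 q2 g k (cnj w) = trig_potential q0 q1 q2 g k w"
proof -
  have "Re (1 / cnj w) = Re (1 / w)" "Re (1 / (cnj w)\<^sup>2) = Re (1 / w\<^sup>2)"
    by (metis complex_cnj_divide complex_cnj_one complex_cnj_power cnj.sel(1))+
  moreover have "cmod (cnj w - k) = cmod (w - k)"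
    by (metis complex_cnj_complex_of_real complex_cnj_diff complex_mod_cnj)
  ultimately show ?thesis by (simp add: trig_potential_def)
qed

lemma meas_integral:
  assumes [measurable]: "f \<in> borel_measurable borel"
  shows "integrable meas f \<longleftrightarrow> integrable lborel (\<lambda>\<theta>. indicator {0..2 * pi} \<theta> * (weight \<theta> / (2 * pi)) * f (point \<theta>))"
    and "integral\<^sup>L meas f = (\<integral>\<theta>. indicator {0..2 * pi} \<theta> * (weight \<theta> / (2 * pi)) * f (point \<theta>) \<partial>lborel)"
proof -
  have *: "integrable meas f \<longleftrightarrow> integrable lborel (\<lambda>\<theta>. (indicator {0..2 * pi} \<theta> * (weight \<theta> / (2 * pi))) *\<^sub>R f (point \<theta>))"
    unfolding meas_eq_distr
    by (subst integrable_distr_eq, simp, simp, subst integrable_density) (auto simp: weight_nonneg)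
  then show "integrable meas f \<longleftrightarrow> integrable lborel (\<lambda>\<theta>. indicator {0..2 * pi} \<theta> * (weight \<theta> / (2 * pi)) * f (point \<theta>))"
    by simp
  have "integral\<^sup>L meas f = (\<integral>\<theta>. (indicator {0..2 * pi} \<theta> * (weight \<theta> / (2 * pi))) *\<^sub>R f (point \<theta>) \<partial>lborel)"
    unfolding meas_eq_distr
    by (subst integral_distr, simp, simp, subst integral_density) (auto simp: weight_nonneg)
  then show "integral\<^sup>L meas f = (\<integral>\<theta>. indicator {0..2 * pi} \<theta> * (weight \<theta> / (2 * pi)) * f (point \<theta>) \<partial>lborel)"
    by simp
qed

lemma meas_AE_neq: "AE s in meas. s \<noteq> x"
  unfolding meas_def using AE_lborel_singleton[of x] by (subst AE_density) auto

lemma log_potential_meas: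
  fixes w :: complex
  assumes w: "1 \<le> cmod w" and x: "complex_of_real x = - (a / 4) * (w - 1)\<^sup>2 / w"
  shows "log_potential meas x
    = ereal (- ((Q0 + \<gamma>) * (ln (a / 4) - ln (cmod w)) + 2 * trig_potential Q0 Q1 Q2 \<gamma> \<kappa> w))"
proof -
  define G where "G w \<theta> = indicator {0..2 * pi} \<theta> * (weight \<theta> * ln (cmod (w - cis \<theta>)))" for w \<theta>
  define H where "H \<theta> = indicator {0..2 * pi} \<theta> * weight \<theta>" for \<theta>
  define C where "C = ln (a / 4) - ln (cmod w)"
  have w0: "w \<noteq> 0" using w by auto
  have G: "has_bochner_integral lborel (G w) (2 * pi * trig_potential Q0 Q1 Q2 \<gamma> \<kappa> w)"
    using trig_potential_integral[OF \<kappa>(3) w weight_nonneg] by (simp add: has_bochner_integral_iff G_def[abs_def])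
  have w': "1 \<le> cmod (cnj w)" using w by simp
  have G': "has_bochner_integral lborel (G (cnj w)) (2 * pi * trig_potential Q0 Q1 Q2 \<gamma> \<kappa> w)"
    using trig_potential_integral[OF \<kappa>(3) w' weight_nonneg]
    by (simp add: has_bochner_integral_iff G_def[abs_def] trig_potential_cnj)
  have "set_integrable lborel {0..2 * pi} weight"
    by (intro borel_integrable_atLeastAtMost' continuous_intros \<kappa>)
  then have H: "has_bochner_integral lborel H (2 * pi * (Q0 + \<gamma>))"
    using set_borel_integral_eq_integral(2)[of "{0..2 * pi}" weight]
      integral_unique[OF trig_weight_integral[OF \<kappa>(3), of Q0 Q1 Q2 \<gamma>]]
    by (simp add: has_bochner_integral_iff set_integrable_def set_lebesgue_integral_def H_def[abs_def])
  have [measurable]: "cis \<in> borel_measurable borel"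
    by (intro borel_measurable_continuous_onI continuous_intros)
  have sum: "has_bochner_integral lborel (\<lambda>\<theta>. (C * H \<theta> + G w \<theta> + G (cnj w) \<theta>) / (2 * pi))
      ((C * (2 * pi * (Q0 + \<gamma>)) + 2 * pi * trig_potential Q0 Q1 Q2 \<gamma> \<kappa> w
        + 2 * pi * trig_potential Q0 Q1 Q2 \<gamma> \<kappa> w) / (2 * pi))"
    by (intro has_bochner_integral_divide has_bochner_integral_add has_bochner_integral_mult_right H G G')
  \<comment> \<open>Where a factor vanishes the logarithm of the product does not split, because
    \<open>ln 0 = 0\<close>; such angles form a null set.\<close>
  have ae: "AE \<theta> in lborel. (C * H \<theta> + G w \<theta> + G (cnj w) \<theta>) / (2 * pi)
      = indicator {0..2 * pi} \<theta> * (weight \<theta> / (2 * pi)) * ln \<bar>x - point \<theta>\<bar>"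
    using AE_cis_neq[of w] AE_cis_neq[of "cnj w"]
  proof eventually_elim
    case (elim \<theta>)
    have "ln \<bar>x - point \<theta>\<bar> = C + ln (cmod (w - cis \<theta>)) + ln (cmod (cnj w - cis \<theta>))"
    proof -
      have L: "ln (p * q * r / d) = ln p - ln d + ln q + ln r" if "0 < p" "0 < q" "0 < r" "0 < d" for p q r d :: real
        using that by (simp add: ln_div ln_mult)
      then show ?thesis
        unfolding dist_point[OF w0 x] C_def by (subst L) (use elim a w0 in auto)
    qed
    then show ?case by (simp add: H_def G_def field_simps)
  qed
  have "has_bochner_integral lborel (\<lambda>\<theta>. indicator {0..2 * pi} \<theta> * (weight \<theta> / (2 * pi)) * ln \<bar>x - point \<theta>\<bar>)
      ((C * (2 * pi * (Q0 + \<gamma>)) + 2 * pi * trig_potential Q0 Q1 Q2 \<gamma> \<kappa> w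
        + 2 * pi * trig_potential Q0 Q1 Q2 \<gamma> \<kappa> w) / (2 * pi))"
    using sum by (subst has_bochner_integral_cong_AE[symmetric, OF _ _ ae])
      (auto dest: borel_measurable_has_bochner_integral)
  then have "integrable meas (\<lambda>s. ln \<bar>x - s\<bar>)"
    "(\<integral>s. ln \<bar>x - s\<bar> \<partial>meas) = (Q0 + \<gamma>) * C + 2 * trig_potential Q0 Q1 Q2 \<gamma> \<kappa> w"
    by (auto simp: meas_integral has_bochner_integral_iff add_divide_distrib)
  then show ?thesis
    by (subst log_potential_eq_integral) (auto simp: meas_AE_neq C_def meas_def)
qed

definition external_field :: "real \<Rightarrow> real" where
  "external_field x = x\<^sup>2 / 2 + \<beta> * x + \<gamma> * ln (x + 1)"

definition level :: real where
  "level = 3 * a\<^sup>2 / 16 + \<beta> * a / 2 + \<gamma> * ln (sqrt (1 + a) / (1 - \<kappa>\<^sup>2)) - (Q0 + \<gamma>) * ln (a / 4)"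

text \<open>As a function of the angle the field consists of a constant,
  \<open>- Q1 * cos \<theta>\<close>, \<open>- Q2 / 2 * cos (2 * \<theta>)\<close> and
  \<open>2 * \<gamma> * ln (cmod (cis \<theta> - \<kappa>))\<close>. Twice
  \<open>trig_potential\<close> has the same nonconstant terms, so they cancel and
  \<open>level\<close> remains.\<close>

lemma potential_inside:
  "log_potential meas (point \<theta>) + ereal (external_field (point \<theta>)) = ereal level"
proof -
  define c where "c = cos \<theta>"
  have V: "log_potential meas (point \<theta>)
      = ereal (- ((Q0 + \<gamma>) * ln (a / 4) + 2 * trig_potential Q0 Q1 Q2 \<gamma> \<kappa> (cis \<theta>)))"
    using log_potential_meas[of "cis \<theta>" "point \<theta>"] by (simp add: point_complex)
  have re: "Re (1 / cis \<theta>) = c" "Re (1 / (cis \<theta>)\<^sup>2) = 2 * c\<^sup>2 - 1"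
  proof -
    have "1 / cis \<theta> = cis (- \<theta>)" by (simp add: divide_inverse cis_inverse)
    moreover have "1 / (cis \<theta>)\<^sup>2 = (1 / cis \<theta>)\<^sup>2" by (simp add: power_one_over)
    ultimately have "1 / cis \<theta> = cis (- \<theta>)" "1 / (cis \<theta>)\<^sup>2 = cis (- (2 * \<theta>))"
      by (simp_all only: Complex.DeMoivre) simp
    then show "Re (1 / cis \<theta>) = c" "Re (1 / (cis \<theta>)\<^sup>2) = 2 * c\<^sup>2 - 1"
      by (simp_all add: c_def cos_double_cos)
  qed
  have pos: "0 < 1 + \<kappa>\<^sup>2 - 2 * \<kappa> * c" unfolding c_def by (rule poisson_kernel_denom_pos[OF \<kappa>(3)])
  have "(cmod (cis \<theta> - \<kappa>))\<^sup>2 = (cos \<theta> - \<kappa>)\<^sup>2 + (sin \<theta>)\<^sup>2" by (simp add: cmod_power2)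
  also have "\<dots> = 1 + \<kappa>\<^sup>2 - 2 * \<kappa> * c"
    by (simp add: sin_squared_eq c_def) (simp add: power2_eq_square algebra_simps)
  finally have sq: "(cmod (cis \<theta> - \<kappa>))\<^sup>2 = 1 + \<kappa>\<^sup>2 - 2 * \<kappa> * c" .
  have \<kappa>2: "\<kappa>\<^sup>2 < 1" using \<kappa>(3) by (simp add: abs_square_less_1)
  have "v = r / u * d" if "u / d = r / v" "u \<noteq> 0" "d \<noteq> 0" "v \<noteq> 0" for u d r v :: real
    using that by (simp add: field_simps)
  from this[OF poisson_kernel_point[unfolded poisson_kernel_def, of \<theta>]]
  have "1 + point \<theta> = sqrt (1 + a) / (1 - \<kappa>\<^sup>2) * (1 + \<kappa>\<^sup>2 - 2 * \<kappa> * c)"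
    using pos point_bounds[of \<theta>] \<kappa>2 by (simp add: c_def)
  then have "ln (point \<theta> + 1) = ln (sqrt (1 + a) / (1 - \<kappa>\<^sup>2)) + ln ((cmod (cis \<theta> - \<kappa>))\<^sup>2)"
    unfolding sq using a pos \<kappa>2 by (subst add.commute, simp only:, subst ln_mult) auto
  also have "ln ((cmod (cis \<theta> - \<kappa>))\<^sup>2) = 2 * ln (cmod (cis \<theta> - \<kappa>))"
    using sq pos by (subst ln_realpow) auto
  finally have ln: "ln (point \<theta> + 1) = ln (sqrt (1 + a) / (1 - \<kappa>\<^sup>2)) + 2 * ln (cmod (cis \<theta> - \<kappa>))" .
  have poly: "(a / 2 * (1 - c))\<^sup>2 / 2 + \<beta> * (a / 2 * (1 - c))
      = 3 * a\<^sup>2 / 16 + \<beta> * a / 2 - Q1 * c - Q2 / 2 * (2 * c\<^sup>2 - 1)"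
    by (simp add: Q1_def Q2_def field_simps power2_eq_square)
  have "external_field (point \<theta>) - ((Q0 + \<gamma>) * ln (a / 4) + 2 * trig_potential Q0 Q1 Q2 \<gamma> \<kappa> (cis \<theta>)) = level"
    unfolding external_field_def ln trig_potential_def re level_def
    using poly by (simp add: point_def c_def[symmetric] distrib_left)
  then show ?thesis unfolding V by simp
qed

text \<open>The point of \<open>[a, \<infinity>)\<close> corresponding to \<open>w = -\<rho>\<close>.\<close>

definition outer :: "real \<Rightarrow> real" where
  "outer \<rho> = a / 4 * (\<rho> + 1)\<^sup>2 / \<rho>"

text \<open>The value of potential plus field at \<open>outer \<rho>\<close>, with all logarithms
  expanded for differentiation. The constant \<open>level\<close> is not subtracted; it is the value
  at \<open>\<rho> = 1\<close>.\<close>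

definition excess :: "real \<Rightarrow> real" where
  "excess \<rho> = (outer \<rho>)\<^sup>2 / 2 + \<beta> * outer \<rho> + \<gamma> * (ln (\<rho> + \<kappa>) + ln (1 + \<kappa> * \<rho>) - ln \<rho> - 2 * ln (1 - \<kappa>))
    - ((Q0 + \<gamma>) * (ln (a / 4) - ln \<rho>) + 2 * (Q0 * ln \<rho> + Q1 / 2 / \<rho> - Q2 / 4 / \<rho>\<^sup>2 + \<gamma> * ln (\<rho> + \<kappa>)))"

text \<open>The pole \<open>x = -1\<close> has the two preimages \<open>\<kappa>\<close> and
  \<open>1 / \<kappa>\<close>; with \<open>w = - \<rho>\<close> each contributes one factor.\<close>

lemma outer_plus_1:
  assumes "\<rho> > 0"
  shows "outer \<rho> + 1 = (\<rho> + \<kappa>) * (1 + \<kappa> * \<rho>) / ((1 - \<kappa>)\<^sup>2 * \<rho>)"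
proof -
  have "k / d * (\<rho> + 1)\<^sup>2 / \<rho> + 1 = (k * (\<rho> + 1)\<^sup>2 + d * \<rho>) / (d * \<rho>)" if "d \<noteq> 0" for k d :: real
    using that assms by (simp add: field_simps)
  from this[of "(1 - \<kappa>)\<^sup>2" \<kappa>] have "outer \<rho> + 1 = (\<kappa> * (\<rho> + 1)\<^sup>2 + (1 - \<kappa>)\<^sup>2 * \<rho>) / ((1 - \<kappa>)\<^sup>2 * \<rho>)"
    using \<kappa> unfolding outer_def by (subst a_eq) simp
  also have "\<kappa> * (\<rho> + 1)\<^sup>2 + (1 - \<kappa>)\<^sup>2 * \<rho> = (\<rho> + \<kappa>) * (1 + \<kappa> * \<rho>)"
    by (simp add: power2_eq_square algebra_simps)
  finally show ?thesis .
qed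

lemma potential_outer:
  assumes "\<rho> \<ge> 1"
  shows "log_potential meas (outer \<rho>) + ereal (external_field (outer \<rho>)) = ereal (excess \<rho>)"
proof -
  have x: "complex_of_real (outer \<rho>) = complex_of_real (- (a / 4)) * (complex_of_real (- \<rho>) - 1)\<^sup>2 / complex_of_real (- \<rho>)"
  proof -
    have "outer \<rho> = - (a / 4) * ((- \<rho>) - 1)\<^sup>2 / (- \<rho>)"
    proof -
      have "(- \<rho> - 1)\<^sup>2 = (\<rho> + 1)\<^sup>2" by (simp add: power2_eq_square algebra_simps)
      then show ?thesis by (simp add: outer_def)
    qed
    then show ?thesis by simp
  qed
  have "cmod (complex_of_real (- \<rho>) - complex_of_real \<kappa>) = \<bar>- \<rho> - \<kappa>\<bar>" by (metis norm_of_real of_real_diff)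
  then have n: "cmod (complex_of_real (- \<rho>) - complex_of_real \<kappa>) = \<rho> + \<kappa>" using assms \<kappa> by simp
  have re: "Re (1 / complex_of_real (- \<rho>)) = - 1 / \<rho>" "Re (1 / (complex_of_real (- \<rho>))\<^sup>2) = 1 / \<rho>\<^sup>2"
    by (metis Re_complex_of_real of_real_1 of_real_divide of_real_power minus_divide_right minus_divide_left power2_minus)+
  have V: "log_potential meas (outer \<rho>) = ereal (- ((Q0 + \<gamma>) * (ln (a / 4) - ln \<rho>)
      + 2 * (Q0 * ln \<rho> + Q1 / 2 / \<rho> - Q2 / 4 / \<rho>\<^sup>2 + \<gamma> * ln (\<rho> + \<kappa>))))"
    using log_potential_meas[OF _ x] assms unfolding trig_potential_def n re by simp
  have "0 < 1 + \<kappa> * \<rho>" "0 < \<rho> + \<kappa>" using assms \<kappa> by (auto intro!: add_pos_nonneg)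
  moreover have "ln ((1 - \<kappa>)\<^sup>2) = 2 * ln (1 - \<kappa>)" using \<kappa> by (simp add: ln_realpow)
  ultimately have "ln (outer \<rho> + 1) = ln (\<rho> + \<kappa>) + ln (1 + \<kappa> * \<rho>) - ln \<rho> - 2 * ln (1 - \<kappa>)"
    using assms \<kappa> by (subst outer_plus_1) (simp_all add: ln_div ln_mult)
  then show ?thesis unfolding V external_field_def excess_def by simp
qed

lemma prod_kappa: "B1 * B2 = \<gamma> * (1 - \<kappa>) / (1 + \<kappa>)"
proof -
  define r where "r = sqrt (1 + a)"
  have r: "r > 1" using a by (simp add: r_def)
  have k: "\<kappa> = (r - 1) / (r + 1)" by (simp add: \<kappa>_def r_def)
  have "1 - \<kappa> = 2 / (r + 1)" "1 + \<kappa> = 2 * r / (r + 1)" using r unfolding k by (simp_all add: field_simps)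
  moreover have "(2 / (r + 1)) / (2 * r / (r + 1)) = 1 / r" using r by (simp add: divide_simps)
  ultimately have "(1 - \<kappa>) / (1 + \<kappa>) = 1 / r" by simp
  then have "\<gamma> * ((1 - \<kappa>) / (1 + \<kappa>)) = \<gamma> / r" by simp
  then show ?thesis by (simp add: prod r_def)
qed

text \<open>The derivative of potential plus field beyond \<open>a\<close> is the density formula
  continued analytically, \<open>(x - b1) * (x - b2) / (x + 1) * sqrt ((x - a) / x)\<close>. For
  \<open>\<rho> \<ge> 1\<close> the root is \<open>(\<rho> - 1) / (\<rho> + 1)\<close>, and its
  product with \<open>a / 4 * (1 - 1 / \<rho>\<^sup>2)\<close>, the derivative of
  \<open>outer\<close>, is the last factor here.\<close>

lemma excess_deriv:
  assumes \<rho>: "\<rho> > 0"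
  shows "(excess has_real_derivative
    (outer \<rho> - (B1 - 1)) * (outer \<rho> - (B2 - 1)) / (outer \<rho> + 1) * (a / 4 * (\<rho> - 1)\<^sup>2 / \<rho>\<^sup>2)) (at \<rho>)"
proof -
  have pos: "0 < 1 + \<kappa> * \<rho>" "0 < \<rho> + \<kappa>" using \<rho> \<kappa> by (auto intro!: add_pos_nonneg)
  define X where "X = outer \<rho>"
  define P where "P = B1 * B2"
  have P: "P = \<gamma> / sqrt (1 + a)" "\<gamma> = P * (1 + \<kappa>) / (1 - \<kappa>)"
    using \<kappa> by (simp add: P_def prod, simp add: P_def prod_kappa)
  have outer': "(outer has_real_derivative a / 4 * (1 - 1 / \<rho>\<^sup>2)) (at \<rho>)"
    unfolding outer_def[abs_def] using \<rho>
    by (auto intro!: derivative_eq_intros) (simp add: field_simps power2_eq_square)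
  have d1: "((\<lambda>\<rho>. (outer \<rho>)\<^sup>2 / 2) has_real_derivative X * (a / 4 * (1 - 1 / \<rho>\<^sup>2))) (at \<rho>)"
    by (rule DERIV_cong[OF DERIV_cdivide[OF DERIV_power[OF outer', of 2], of 2]]) (simp add: X_def field_simps)
  have d2: "((\<lambda>\<rho>. ln (\<rho> + \<kappa>)) has_real_derivative 1 / (\<rho> + \<kappa>)) (at \<rho>)"
      "((\<lambda>\<rho>. ln (1 + \<kappa> * \<rho>)) has_real_derivative \<kappa> / (1 + \<kappa> * \<rho>)) (at \<rho>)"
      "(ln has_real_derivative 1 / \<rho>) (at \<rho>)"
    using \<rho> pos by (auto intro!: derivative_eq_intros)
  have d3: "((\<lambda>\<rho>. Q1 / 2 / \<rho>) has_real_derivative - (Q1 / 2 / \<rho>\<^sup>2)) (at \<rho>)"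
      "((\<lambda>\<rho>. Q2 / 4 / \<rho>\<^sup>2) has_real_derivative - (Q2 / 2 / \<rho> ^ 3)) (at \<rho>)"
    using \<rho> by (auto intro!: derivative_eq_intros simp: field_simps power2_eq_square power3_eq_cube)
  have "(excess has_real_derivative
      X * (a / 4 * (1 - 1 / \<rho>\<^sup>2)) + \<beta> * (a / 4 * (1 - 1 / \<rho>\<^sup>2))
      + \<gamma> * (1 / (\<rho> + \<kappa>) + \<kappa> / (1 + \<kappa> * \<rho>) - 1 / \<rho> - 0)
      - ((Q0 + \<gamma>) * (0 - 1 / \<rho>) + 2 * (Q0 * (1 / \<rho>) + - (Q1 / 2 / \<rho>\<^sup>2) - - (Q2 / 2 / \<rho> ^ 3) + \<gamma> * (1 / (\<rho> + \<kappa>))))) (at \<rho>)"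
    (is "(_ has_real_derivative ?D) _")
    unfolding excess_def[abs_def]
    by (intro DERIV_add DERIV_diff DERIV_cmult DERIV_const d1 d2 d3 outer')
  also have "?D = (X + \<beta> + a / 2) * (a / 4 * (\<rho> - 1)\<^sup>2 / \<rho>\<^sup>2)
      + (\<gamma> * (\<kappa> / (1 + \<kappa> * \<rho>) - 1 / (\<rho> + \<kappa>)) + P / \<rho>)"
  proof -
    \<comment> \<open>In terms of \<open>i\<close>, and with \<open>X * i\<close> replaced by
      \<open>a / 4 * (1 + i)\<^sup>2\<close>, the part without the pole becomes a polynomial
      identity.\<close>
    define i where "i = 1 / \<rho>"
    have i: "1 / \<rho>\<^sup>2 = i\<^sup>2" "Q1 / 2 / \<rho>\<^sup>2 = Q1 / 2 * i\<^sup>2" "Q2 / 2 / \<rho> ^ 3 = Q2 / 2 * i ^ 3" "P / \<rho> = P * i"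
      by (simp_all add: i_def power_one_over divide_simps)
    have "X * i = a / 4 * ((\<rho> + 1) * i)\<^sup>2"
      by (simp add: X_def outer_def i_def power2_eq_square)
    also have "(\<rho> + 1) * i = 1 + i" using \<rho> by (simp add: i_def add_divide_distrib)
    finally have Xi: "X * i = a / 4 * (1 + i)\<^sup>2" .
    have "(\<rho> - 1)\<^sup>2 / \<rho>\<^sup>2 = ((\<rho> - 1) / \<rho>)\<^sup>2" by (simp add: power_divide)
    also have "(\<rho> - 1) / \<rho> = 1 - i" using \<rho> by (simp add: i_def diff_divide_distrib)
    finally have "(\<rho> - 1)\<^sup>2 / \<rho>\<^sup>2 = (1 - i)\<^sup>2" .
    moreover have "a / 4 * (\<rho> - 1)\<^sup>2 / \<rho>\<^sup>2 = a / 4 * ((\<rho> - 1)\<^sup>2 / \<rho>\<^sup>2)" by simp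
    ultimately have v: "a / 4 * (\<rho> - 1)\<^sup>2 / \<rho>\<^sup>2 = a / 4 * (1 - i)\<^sup>2" by (simp only:)
    have Q0: "Q0 = 3 * a\<^sup>2 / 8 + a * \<beta> / 2 - P" by (simp add: Q0_def P(1))
    have "(X + \<beta>) * (a / 4 * (1 - i\<^sup>2)) = (X + \<beta>) * (a / 4 * (1 - i)\<^sup>2) + a / 2 * (1 - i) * (X * i + \<beta> * i)"
      by (simp add: field_simps power2_eq_square)
    also have "a / 2 * (1 - i) * (X * i + \<beta> * i) = a / 2 * (a / 4 * (1 - i)\<^sup>2)
        + ((3 * a\<^sup>2 / 8 + a * \<beta> / 2) * i - Q1 * i\<^sup>2 + Q2 * i ^ 3)"
      unfolding Xi Q1_def Q2_def by (simp add: field_simps power2_eq_square power3_eq_cube)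
    finally have main: "(X + \<beta>) * (a / 4 * (1 - i\<^sup>2)) = (X + \<beta> + a / 2) * (a / 4 * (1 - i)\<^sup>2)
        + ((3 * a\<^sup>2 / 8 + a * \<beta> / 2) * i - Q1 * i\<^sup>2 + Q2 * i ^ 3)"
      by (simp add: distrib_right)
    have lin: "X * u + \<beta> * u + \<gamma> * (p + k - i - 0) - ((Q0 + \<gamma>) * (0 - i) + 2 * (Q0 * i + - (Q1 / 2 * i\<^sup>2) - - (Q2 / 2 * i ^ 3) + \<gamma> * p))
        = (X + \<beta>) * u - (Q0 + P) * i + Q1 * i\<^sup>2 - Q2 * i ^ 3 + (\<gamma> * (k - p) + P * i)" for u p k
      by (simp add: algebra_simps)
    have "Q0 + P = 3 * a\<^sup>2 / 8 + a * \<beta> / 2" by (simp add: Q0)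
    then show ?thesis
      unfolding v i i_def[symmetric] lin main by simp
  qed
  \<comment> \<open>The term \<open>P / \<rho>\<close>, taken out of \<open>Q0\<close>, gives the
    pole part its double zero at \<open>\<rho> = 1\<close>; this uses the relation between
    \<open>P\<close> and \<open>\<gamma>\<close> from \<open>prod_kappa\<close>.\<close>
  also have "\<gamma> * (\<kappa> / (1 + \<kappa> * \<rho>) - 1 / (\<rho> + \<kappa>)) + P / \<rho> = P / (X + 1) * (a / 4 * (\<rho> - 1)\<^sup>2 / \<rho>\<^sup>2)"
  proof -
    have "\<kappa> / (1 + \<kappa> * \<rho>) - 1 / (\<rho> + \<kappa>) = (\<kappa>\<^sup>2 - 1) / ((1 + \<kappa> * \<rho>) * (\<rho> + \<kappa>))"
      using pos by (simp add: divide_simps) (simp add: power2_eq_square algebra_simps)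
    moreover have "\<gamma> * (\<kappa>\<^sup>2 - 1) = - P * (1 + \<kappa>)\<^sup>2"
    proof -
      have "P * s / d * (- (d * s)) = - P * s\<^sup>2" if "d \<noteq> 0" for s d
        using that by (simp add: power2_eq_square)
      from this[of "1 - \<kappa>" "1 + \<kappa>"] have "\<gamma> * (- ((1 - \<kappa>) * (1 + \<kappa>))) = - P * (1 + \<kappa>)\<^sup>2"
        using \<kappa> by (simp only: P(2))
      moreover have "- ((1 - \<kappa>) * (1 + \<kappa>)) = \<kappa>\<^sup>2 - 1" by (simp add: power2_eq_square algebra_simps)
      ultimately show ?thesis by simp
    qed
    ultimately have "\<gamma> * (\<kappa> / (1 + \<kappa> * \<rho>) - 1 / (\<rho> + \<kappa>)) + P / \<rho>
        = - P * (1 + \<kappa>)\<^sup>2 / ((1 + \<kappa> * \<rho>) * (\<rho> + \<kappa>)) + P / \<rho>" by simp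
    also have "\<dots> = P * (\<kappa> * (\<rho> - 1)\<^sup>2) / (\<rho> * ((1 + \<kappa> * \<rho>) * (\<rho> + \<kappa>)))"
    proof -
      have "\<kappa> * (\<rho> - 1)\<^sup>2 = (1 + \<kappa> * \<rho>) * (\<rho> + \<kappa>) - (1 + \<kappa>)\<^sup>2 * \<rho>"
        by (simp add: power2_eq_square algebra_simps)
      moreover have "- P * u / d + P / \<rho> = P * (d - u * \<rho>) / (\<rho> * d)" if "d \<noteq> 0" for u d
        using that \<rho> by (simp add: divide_simps) (simp add: algebra_simps)
      ultimately show ?thesis using pos by simp
    qed
    also have "\<dots> = P / (X + 1) * (\<kappa> / (1 - \<kappa>)\<^sup>2 * (\<rho> - 1)\<^sup>2 / \<rho>\<^sup>2)"
    proof -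
      have "P * (\<kappa> * M) / (\<rho> * W) = P / (W / (d * \<rho>)) * (\<kappa> / d * M / \<rho>\<^sup>2)" if "W > 0" "d \<noteq> 0" for M W d
        using that \<rho> by (simp add: power2_eq_square)
      from this[of "(\<rho> + \<kappa>) * (1 + \<kappa> * \<rho>)" "(1 - \<kappa>)\<^sup>2" "(\<rho> - 1)\<^sup>2"] show ?thesis
        unfolding X_def outer_plus_1[OF \<rho>] using pos \<kappa> by (simp only: mult.commute[of "1 + \<kappa> * \<rho>"]) simp
    qed
    also have "\<kappa> / (1 - \<kappa>)\<^sup>2 = a / 4" by (subst a_eq) simp
    finally show ?thesis .
  qed
  also have "(X + \<beta> + a / 2) * (a / 4 * (\<rho> - 1)\<^sup>2 / \<rho>\<^sup>2) + P / (X + 1) * (a / 4 * (\<rho> - 1)\<^sup>2 / \<rho>\<^sup>2)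
      = ((X - (B1 - 1)) * (X - (B2 - 1)) / (X + 1)) * (a / 4 * (\<rho> - 1)\<^sup>2 / \<rho>\<^sup>2)"
  proof -
    have "X + 1 > 0" using \<rho> a by (simp add: X_def outer_def add_nonneg_pos)
    have "(X - (B1 - 1)) * (X - (B2 - 1)) = (X + 1)\<^sup>2 - (B1 + B2) * (X + 1) + P"
      by (simp add: P_def power2_eq_square algebra_simps)
    then have "(X - (B1 - 1)) * (X - (B2 - 1)) / (X + 1) = X + 1 - (B1 + B2) + P / (X + 1)"
      using \<open>X + 1 > 0\<close> by (simp add: add_divide_distrib diff_divide_distrib power2_eq_square)
    then have "(X - (B1 - 1)) * (X - (B2 - 1)) / (X + 1) = (X + \<beta> + a / 2) + P / (X + 1)"
      by (simp add: sum)
    then show ?thesis by (simp only: distrib_right)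
  qed
  finally show ?thesis by (simp only: X_def)
qed

lemma excess_mono:
  assumes "1 \<le> \<rho>"
  shows "excess 1 \<le> excess \<rho>"
proof (rule DERIV_nonneg_imp_nondecreasing[OF assms])
  fix y :: real assume "1 \<le> y"
  then have y: "y > 0" by simp
  have "outer y \<ge> 0" using y a by (simp add: outer_def)
  then have "(outer y - (B1 - 1)) * (outer y - (B2 - 1)) / (outer y + 1) * (a / 4 * (y - 1)\<^sup>2 / y\<^sup>2) \<ge> 0"
    using B a by (intro mult_nonneg_nonneg divide_nonneg_nonneg) auto
  then show "\<exists>d. (excess has_real_derivative d) (at y) \<and> 0 \<le> d"
    using excess_deriv[OF y] by blast
qed

lemma excess_1: "excess 1 = level"
proof -
  have "outer 1 = point pi" by (simp add: outer_def point_def)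
  then show ?thesis using potential_inside[of pi] potential_outer[of 1] by simp
qed

section \<open>Support and equilibrium conditions\<close>

lemma measure_support_meas: "measure_support meas = {0..a}"
proof
  have "emeasure meas (- {0..a}) = 0"
    unfolding meas_def by (subst emeasure_density) (auto simp: nn_integral_0_iff_AE split: split_indicator)
  moreover have "open (- {0..a})" by (simp add: open_Compl)
  ultimately have "measure_support meas \<inter> - {0..a} = {}"
    unfolding measure_support_def by (metis (mono_tags, lifting) Int_emptyI less_irrefl mem_Collect_eq)
  then show "measure_support meas \<subseteq> {0..a}" by blast
  show "{0..a} \<subseteq> measure_support meas"
  proof
    fix x assume x: "x \<in> {0..a}"
    show "x \<in> measure_support meas"
      unfolding measure_support_def
    proof (intro CollectI allI impI)
      fix U assume U: "open U" "x \<in> U"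
      have [measurable]: "U \<in> sets borel" using U by simp
      show "0 < emeasure meas U"
      proof (rule ccontr)
        assume "\<not> 0 < emeasure meas U"
        then have "(\<integral>\<^sup>+x. ennreal (indicator {0<..<a} x * dens x) * indicator U x \<partial>lborel) = 0"
          by (simp add: meas_def emeasure_density)
        then have "AE x in lborel. ennreal (indicator {0<..<a} x * dens x) * indicator U x = 0"
          by (subst (asm) nn_integral_0_iff_AE) auto
        moreover have "dens x > 0" if "0 < x" "x < a" for x
          unfolding dens_def using that B by (intro mult_pos_pos divide_pos_pos real_sqrt_gt_zero) auto
        ultimately have "AE x in lborel. x \<notin> {0<..<a} \<inter> U"
          by (auto elim!: eventually_mono split: split_indicator_asm simp: ennreal_eq_0_iff not_le[symmetric])
        then have "{0<..<a} \<inter> U \<in> null_sets lborel"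
          by (subst AE_iff_null_sets) auto
        moreover have "open ({0<..<a} \<inter> U)" using U by auto
        ultimately have "{0<..<a} \<inter> U = {}"
          using open_not_negligible[of "{0<..<a} \<inter> U"] null_sets_completionI[of "{0<..<a} \<inter> U" lborel]
          by (auto simp: negligible_iff_null_sets)
        \<comment> \<open>Positivity of the density is known only in the open interval; the closure
          brings in the endpoints.\<close>
        then have "U \<inter> closure {0<..<a} = {}"
          using open_Int_closure_eq_empty[OF U(1), of "{0<..<a}"] by auto
        then show False using U x a by auto
      qed
    qed
  qed
qed

theorem is_equilibrium_measure_meas: "is_equilibrium_measure {0..} external_field (Q0 + \<gamma>) meas"
  unfolding is_equilibrium_measure_def measure_support_meas
proof (intro conjI exI[of _ level] ballI)
  show "sets meas = sets borel" by (simp add: meas_def)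
  have "emeasure meas {0..} = emeasure meas UNIV"
    unfolding meas_def by (subst (1 2) emeasure_density) (auto intro!: nn_integral_cong split: split_indicator)
  then show "emeasure meas {0..} = ennreal (Q0 + \<gamma>)" using meas_mass by simp
  have inside: "log_potential meas x + ereal (external_field x) = ereal level" if "0 \<le> x" "x \<le> a" for x
  proof -
    have "\<bar>1 - 2 * x / a\<bar> \<le> 1" using that a by (simp add: abs_le_iff field_simps)
    then have "cos (arccos (1 - 2 * x / a)) = 1 - 2 * x / a" by (rule cos_arccos_abs)
    then have "point (arccos (1 - 2 * x / a)) = x" using a by (simp add: point_def)
    then show ?thesis using potential_inside by metis
  qed
  then show "log_potential meas x + ereal (external_field x) = ereal level" if "x \<in> {0..a}" for x using that by simp
  show "ereal level \<le> log_potential meas x + ereal (external_field x)" if "x \<in> {0..}" for x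
  proof (cases "x \<le> a")
    case True
    then show ?thesis using inside[of x] that by simp
  next
    case False
    define y where "y = 4 * x / a"
    have y: "y > 4" using False a by (simp add: y_def field_simps)
    \<comment> \<open>This solves \<open>outer \<rho> = x\<close>. The left side
      \<open>(\<rho> + 1)\<^sup>2 / \<rho> = \<rho> + 2 + 1 / \<rho>\<close> is 4 at 1 and exceeds
      \<open>y\<close> at \<open>y\<close>.\<close>
    have "\<exists>\<rho>\<ge>1. \<rho> \<le> y \<and> (\<rho> + 1)\<^sup>2 / \<rho> = y"
    proof (rule IVT')
      show "(1 + 1)\<^sup>2 / 1 \<le> y" using y by simp
      show "y \<le> (y + 1)\<^sup>2 / y" using y by (simp add: field_simps power2_eq_square)
      show "continuous_on {1..y} (\<lambda>\<rho>. (\<rho> + 1)\<^sup>2 / \<rho>)" by (intro continuous_intros) auto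
    qed (use y in auto)
    then obtain \<rho> where \<rho>: "\<rho> \<ge> 1" "(\<rho> + 1)\<^sup>2 / \<rho> = y" by auto
    have "outer \<rho> = a / 4 * ((\<rho> + 1)\<^sup>2 / \<rho>)" by (simp add: outer_def)
    then have "outer \<rho> = x" using a by (simp add: \<rho>(2) y_def)
    then show ?thesis
      using potential_outer[OF \<rho>(1)] excess_mono[OF \<rho>(1)] excess_1 by simp
  qed
qed auto

end

section \<open>Choice of the right endpoint\<close>

context
  fixes \<beta> \<gamma> :: real
begin

text \<open>By the locale conditions, \<open>B1\<close> and \<open>B2\<close> are the roots of
  \<open>z\<^sup>2 - root_sum a * z + root_prod a\<close>.\<close>

definition root_sum :: "real \<Rightarrow> real" where "root_sum a = 1 - \<beta> - a / 2"
definition root_prod :: "real \<Rightarrow> real" where "root_prod a = \<gamma> / sqrt (1 + a)"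
definition discr :: "real \<Rightarrow> real" where "discr a = (root_sum a)\<^sup>2 - 4 * root_prod a"
definition upper_root :: "real \<Rightarrow> real" where "upper_root a = (root_sum a + sqrt (discr a)) / 2"
definition lower_root :: "real \<Rightarrow> real" where "lower_root a = (root_sum a - sqrt (discr a)) / 2"
definition total_mass :: "real \<Rightarrow> real" where
  "total_mass a = 3 * a\<^sup>2 / 8 + a * \<beta> / 2 + (\<gamma> - \<gamma> / sqrt (1 + a))"

lemma root_prod_lim: "(root_prod \<longlongrightarrow> 0) at_top"
  unfolding root_prod_def by real_asymp

lemma discr_lim: "filterlim discr at_top at_top"
proof -
  have "filterlim (\<lambda>a. (root_sum a)\<^sup>2) at_top at_top" unfolding root_sum_def by real_asymp
  moreover have "((\<lambda>a. - (4 * root_prod a)) \<longlongrightarrow> - (4 * 0)) at_top" by (intro tendsto_intros root_prod_lim)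
  ultimately have "filterlim (\<lambda>a. - (4 * root_prod a) + (root_sum a)\<^sup>2) at_top at_top"
    by (intro filterlim_tendsto_add_at_top)
  then show ?thesis by (simp add: discr_def[abs_def])
qed

lemma lower_root_lim: "filterlim lower_root at_bot at_top"
proof (rule filterlim_at_bot_mono)
  show "filterlim (\<lambda>a. root_sum a / 2) at_bot at_top" unfolding root_sum_def by real_asymp
  have "\<forall>\<^sub>F a in at_top. discr a \<ge> 0"
    using discr_lim by (simp add: filterlim_at_top)
  then show "\<forall>\<^sub>F a in at_top. lower_root a \<le> root_sum a / 2"
    by eventually_elim (simp add: lower_root_def)
qed

lemma roots:
  assumes "discr a > 0"
  shows "upper_root a + lower_root a = root_sum a" "upper_root a * lower_root a = root_prod a"
    "lower_root a < upper_root a"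
proof -
  have "upper_root a * lower_root a = ((root_sum a)\<^sup>2 - (sqrt (discr a))\<^sup>2) / 4"
    by (simp add: upper_root_def lower_root_def power2_eq_square field_simps)
  then show "upper_root a * lower_root a = root_prod a" using assms by (simp add: discr_def)
qed (use assms in \<open>simp_all add: upper_root_def lower_root_def field_simps\<close>)

text \<open>In the definition of \<open>upper_root\<close> two quantities of opposite sign grow
  without bound. Dividing the product of the roots, which tends to 0, by the lower root, which tends
  to minus infinity, avoids the cancellation.\<close>

lemma upper_root_lim: "(upper_root \<longlongrightarrow> 0) at_top"
proof -
  have "filterlim lower_root at_infinity at_top"
    using lower_root_lim by (rule filterlim_mono[OF _ at_bot_le_at_infinity order_refl])
  then have "((\<lambda>a. root_prod a / lower_root a) \<longlongrightarrow> 0) at_top"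
    by (rule tendsto_divide_0[OF root_prod_lim])
  moreover have "\<forall>\<^sub>F a in at_top. discr a > 0 \<and> lower_root a < 0"
    using discr_lim lower_root_lim by (auto simp: filterlim_at_top_dense filterlim_at_bot_dense intro: eventually_conj)
  then have "\<forall>\<^sub>F a in at_top. root_prod a / lower_root a = upper_root a"
    by eventually_elim (use roots(2) in \<open>simp add: field_simps\<close>)
  ultimately show ?thesis by (simp add: tendsto_cong)
qed

lemma total_mass_lim: "filterlim total_mass at_top at_top"
proof -
  have "filterlim (\<lambda>a. 3 * a\<^sup>2 / 8 + a * \<beta> / 2) at_top at_top" by real_asymp
  moreover have "((\<lambda>a. \<gamma> - root_prod a) \<longlongrightarrow> \<gamma> - 0) at_top" by (intro tendsto_intros root_prod_lim)
  ultimately have "filterlim (\<lambda>a. (\<gamma> - root_prod a) + (3 * a\<^sup>2 / 8 + a * \<beta> / 2)) at_top at_top"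
    by (rule filterlim_tendsto_add_at_top[rotated])
  then show ?thesis by (simp add: total_mass_def[abs_def] root_prod_def add.commute)
qed

lemma total_mass_continuous: "A \<ge> 0 \<Longrightarrow> continuous_on {A..B} total_mass"
  unfolding total_mass_def[abs_def] by (intro continuous_intros) auto

text \<open>The intermediate value theorem yields some \<open>a\<close> for each mass beyond
  \<open>total_mass A\<close>, and \<open>a1\<close> chooses one. Every choice tends to infinity,
  because \<open>total_mass\<close> is bounded on each compact interval \<open>{A..K}\<close> and
  larger masses need \<open>a > K\<close>.\<close>

lemma endpoint_exists:
  obtains A T a1 where "A > 0" "T > 0"
    "\<And>a. a \<ge> A \<Longrightarrow> discr a > 0 \<and> upper_root a < 1 \<and> lower_root a < 0"
    "\<And>t. t > T \<Longrightarrow> a1 t \<ge> A \<and> total_mass (a1 t) = t"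
    "filterlim a1 at_top at_top"
proof -
  have "\<forall>\<^sub>F a in at_top. discr a > 0 \<and> upper_root a < 1 \<and> lower_root a < 0"
    using discr_lim lower_root_lim order_tendstoD(2)[OF upper_root_lim, of 1]
    by (auto simp: filterlim_at_top_dense filterlim_at_bot_dense intro!: eventually_conj)
  then have "\<forall>\<^sub>F a in at_top. a > 0 \<and> discr a > 0 \<and> upper_root a < 1 \<and> lower_root a < 0"
    using eventually_gt_at_top[of "0::real"] by eventually_elim simp
  then obtain A where A: "\<And>a. a \<ge> A \<Longrightarrow> a > 0 \<and> discr a > 0 \<and> upper_root a < 1 \<and> lower_root a < 0"
    by (auto simp: eventually_at_top_linorder)
  then have "A > 0" by blast
  define T where "T = max 1 (total_mass A)"
  define a1 where "a1 t = (SOME a. a \<ge> A \<and> total_mass a = t)" for t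
  have ex: "\<exists>a\<ge>A. total_mass a = t" if "t > T" for t
  proof -
    have "\<forall>\<^sub>F b in at_top. total_mass b \<ge> t \<and> b \<ge> A"
      using total_mass_lim by (auto simp: filterlim_at_top intro!: eventually_conj eventually_ge_at_top)
    then obtain b where b: "total_mass b \<ge> t" "b \<ge> A" by (auto simp: eventually_at_top_linorder)
    have "total_mass A \<le> t" using that by (simp add: T_def)
    then show ?thesis
      using IVT'[of total_mass A t b] b \<open>A > 0\<close> total_mass_continuous[of A b] by auto
  qed
  have a1: "a1 t \<ge> A \<and> total_mass (a1 t) = t" if "t > T" for t
    unfolding a1_def by (rule someI_ex) (use ex[OF that] in blast)
  have "filterlim a1 at_top at_top"
    unfolding filterlim_at_top
  proof
    fix K
    have "compact (total_mass ` {A..K})"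
      using \<open>A > 0\<close> by (intro compact_continuous_image total_mass_continuous) auto
    then obtain C where C: "\<And>a. a \<in> {A..K} \<Longrightarrow> \<bar>total_mass a\<bar> \<le> C"
      using compact_imp_bounded by (fastforce simp: bounded_iff)
    show "\<forall>\<^sub>F t in at_top. K \<le> a1 t"
      using eventually_gt_at_top[of "max T C"]
    proof eventually_elim
      case (elim t)
      then have "a1 t \<ge> A" "total_mass (a1 t) = t" using a1[of t] by auto
      then show ?case using C[of "a1 t"] elim by (cases "a1 t \<le> K") auto
    qed
  qed
  then show ?thesis
    using that[of A T a1] A a1 \<open>A > 0\<close> by (simp add: T_def)
qed

end

theorem theorem2p2:
  fixes \<beta> \<gamma> :: real
    and \<phi> :: "real \<Rightarrow> real"
    and \<nu> :: "real \<Rightarrow> real measure"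
  assumes "\<gamma> \<noteq> 0"
    and "\<And>x. \<phi> x = x\<^sup>2 / 2 + \<beta> * x + \<gamma> * ln (x + 1)"
    and "\<And>t. t > 0 \<Longrightarrow> \<nu> t = equilibrium_measure {0..} \<phi> t"
  shows "\<exists>T>0. \<exists>a1 b1 b2 :: real \<Rightarrow> real.
      (\<forall>t>T.
         a1 t > 0 \<and> b2 t < b1 t \<and> b2 t < -1 \<and> b1 t < 0 \<and>
         absolutely_continuous lborel (\<nu> t) \<and>
         measure_support (\<nu> t) = {0..a1 t} \<and>
         \<nu> t = density lborel (\<lambda>x. ennreal (indicator {0<..<a1 t} x *
                 (1 / pi * ((x - b1 t) * (x - b2 t) / (x + 1)) * sqrt ((a1 t - x) / x))))) \<and>
      filterlim a1 at_top at_top \<and>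
      filterlim b2 at_bot at_top \<and>
      (b1 \<longlongrightarrow> -1) at_top"
proof -
  obtain A T a1 where AT: "A > 0" "T > 0"
    and roots_A: "\<And>a. a \<ge> A \<Longrightarrow> discr \<beta> \<gamma> a > 0 \<and> upper_root \<beta> \<gamma> a < 1 \<and> lower_root \<beta> \<gamma> a < 0"
    and a1: "\<And>t. t > T \<Longrightarrow> a1 t \<ge> A \<and> total_mass \<beta> \<gamma> (a1 t) = t"
    and a1_lim: "filterlim a1 at_top at_top"
    using endpoint_exists by metis
  \<comment> \<open>The locale works with \<open>b + 1\<close>. So the bounds 1 and 0 on the upper
    and lower root become \<open>b1 t < 0\<close> and \<open>b2 t < -1\<close>, and the limit 0 of
    the upper root becomes -1.\<close>
  define b1 where "b1 t = upper_root \<beta> \<gamma> (a1 t) - 1" for t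
  define b2 where "b2 t = lower_root \<beta> \<gamma> (a1 t) - 1" for t
  have "a1 t > 0 \<and> b2 t < b1 t \<and> b2 t < -1 \<and> b1 t < 0 \<and>
         absolutely_continuous lborel (\<nu> t) \<and>
         measure_support (\<nu> t) = {0..a1 t} \<and>
         \<nu> t = density lborel (\<lambda>x. ennreal (indicator {0<..<a1 t} x *
                 (1 / pi * ((x - b1 t) * (x - b2 t) / (x + 1)) * sqrt ((a1 t - x) / x))))"
    if t: "t > T" for t
  proof -
    note roots_t = roots_A[OF conjunct1[OF a1[OF t]]]
    note vieta = roots[OF conjunct1[OF roots_t]]
    have "a1 t > 0" "t > 0" using a1[OF t] AT t by auto
    interpret sqrt_density "a1 t" \<beta> \<gamma> "upper_root \<beta> \<gamma> (a1 t)" "lower_root \<beta> \<gamma> (a1 t)"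
      by unfold_locales (use vieta roots_t \<open>a1 t > 0\<close> in \<open>auto simp: root_sum_def root_prod_def\<close>)
    have "Q0 + \<gamma> = t" using a1[OF t] by (simp add: Q0_def total_mass_def)
    moreover have "external_field = \<phi>" by (rule ext) (simp add: external_field_def assms(2))
    ultimately have eq: "is_equilibrium_measure {0..} \<phi> t meas"
      using is_equilibrium_measure_meas by simp
    have "continuous_on {0..} \<phi>"
      unfolding assms(2)[abs_def] by (intro continuous_intros) auto
    then have "equilibrium_measure {0..} \<phi> t = meas"
      unfolding equilibrium_measure_def using eq \<open>t > 0\<close>
      by (intro the_equality) (auto intro: equilibrium_measure_unique)
    then have \<nu>: "\<nu> t = meas" using assms(3) \<open>t > 0\<close> by simp
    have "absolutely_continuous lborel meas"
      unfolding meas_def by (rule absolutely_continuousI_density) measurable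
    then show ?thesis
      using \<open>a1 t > 0\<close> roots_t vieta(3) unfolding \<nu> measure_support_meas
      by (simp add: b1_def b2_def meas_def dens_def)
  qed
  moreover have "filterlim b2 at_bot at_top"
    by (rule filterlim_at_bot_mono[OF filterlim_compose[OF lower_root_lim[of \<beta> \<gamma>] a1_lim]]) (simp add: b2_def)
  moreover have "(b1 \<longlongrightarrow> -1) at_top"
    using tendsto_diff[OF filterlim_compose[OF upper_root_lim[of \<beta> \<gamma>] a1_lim] tendsto_const[of 1]]
    by (simp add: b1_def[abs_def])
  ultimately show ?thesis using AT(2) a1_lim by blast
qed

end
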